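(* Let $A$ be a real $n$-by-$m$ matrix with $n\ge m$. The output of $[R,W,Y]=QRR(A)$, computed in floating point arithmetic, satisfies $$(I-WY+\delta Q^T)(A+\delta A)=\left[\begin{array}{c}R\\0_{(n-m)\times m}\end{array}\right],$$ where $Q^T\equiv I-WY+\delta Q^T$ satisfies $QQ^T=I$ exactly, $\|\delta Q^T\|=O(\varepsilon)$, and $\|\delta A\|=O(\varepsilon)\|A\|$. Here $O(\cdot)$ absorbs all factors of the form $n^c$ with $c$ constant.
   Context: Arithmetic is floating point with machine epsilon $\varepsilon$; matrix products are computed by a (fast) matrix multiplication algorithm that is stable: the computed product of $n$-by-$n$ matrices satisfies $\|C_{comp}-A\cdot B\|\le\mu(n)\varepsilon\|A\|\,\|B\|+O(\varepsilon^2)$ with $\mu(n)=O(n^c)$ for a constant $c$. Error statements are to first order in $\varepsilon$. Algorithm $[R,W,Y]=QRR(A)$ for $A$ $n$-by-$m$, $n\ge m$ (in exact arithmetic it returns $R$ $m$-by-$m$ upper triangular, $W$ $n$-by-$m$ with unit 2-norm columns, $Y$ $m$-by-$n$ with rows of 2-norm 2, such that $Q^T=I-WY$ is orthogonal and $A=Q[R;0]$). Write $p=\lfloor m/2\rfloor$, $q=\lceil m/2\rceil$, and use MATLAB notation ($[X;Z]$ stacks $X$ on $Z$; $zeros(i,j)$ is the $i$-by-$j$ zero matrix). If $m=1$: compute $W,Y$ conventionally as a Householder transformation with $\|W\|_2=1$, $\|Y\|_2=2$, $R=\pm\|A\|_2$. Otherwise: (a) $[R_L,W_L,Y_L]=QRR(A(1:n,1:p))$;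 (b) $A(1:n,p+1:m)=A(1:n,p+1:m)-W_L\cdot(Y_L\cdot A(1:n,p+1:m))$; (c) $[R_R,W_R,Y_R]=QRR(A(p+1:n,p+1:m))$; (d) $X=W_L-[zeros(p,p);\,W_R\cdot(Y_R\cdot W_L(p+1:n,1:p))]$; then $R=[[R_L,A(1:p,p+1:m)];[zeros(q,p),R_R]]$, $W=[X,[zeros(p,q);W_R]]$, $Y=[Y_L;[zeros(q,p),Y_R]]$. *)

theory Defs
  imports "Jordan_Normal_Form.Matrix" "HOL-Library.Landau_Symbols"
begin

section \<open>Norms\<close>

definition vnorm :: "real vec \<Rightarrow> real" where
  "vnorm x = sqrt (x \<bullet> x)"

text \<open>The spectral norm. Any other of the usual matrix norms differs from it by a factor that is
  polynomial in the dimensions.\<close>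

definition mnorm :: "real mat \<Rightarrow> real" where
  "mnorm A = (SUP x\<in>{x \<in> carrier_vec (dim_col A). vnorm x \<le> 1}. vnorm (A *\<^sub>v x))"

section \<open>Floating point arithmetic\<close>

record fl_arith =
  fl_add :: "real \<Rightarrow> real \<Rightarrow> real"
  fl_sub :: "real \<Rightarrow> real \<Rightarrow> real"
  fl_mul :: "real \<Rightarrow> real \<Rightarrow> real"
  fl_div :: "real \<Rightarrow> real \<Rightarrow> real"
  fl_sqrt :: "real \<Rightarrow> real"

text \<open>The standard model: every single operation has relative error at most
  \<open>\<epsilon>\<close> (there is no overflow or underflow).\<close>

definition standard_model :: "real \<Rightarrow> fl_arith \<Rightarrow> bool" where
  "standard_model \<epsilon> F \<longleftrightarrow>
     (\<forall>x y. \<bar>fl_add F x y - (x + y)\<bar> \<le> \<epsilon> * \<bar>x + y\<bar>) \<and>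
     (\<forall>x y. \<bar>fl_sub F x y - (x - y)\<bar> \<le> \<epsilon> * \<bar>x - y\<bar>) \<and>
     (\<forall>x y. \<bar>fl_mul F x y - x * y\<bar> \<le> \<epsilon> * \<bar>x * y\<bar>) \<and>
     (\<forall>x y. y \<noteq> 0 \<longrightarrow> \<bar>fl_div F x y - x / y\<bar> \<le> \<epsilon> * \<bar>x / y\<bar>) \<and>
     (\<forall>x\<ge>0. \<bar>fl_sqrt F x - sqrt x\<bar> \<le> \<epsilon> * sqrt x)"

text \<open>\<open>mm \<epsilon> A B\<close> is the product of \<open>A\<close> and \<open>B\<close> as computed with machine epsilon \<open>\<epsilon>\<close>.
  An \<open>n\<close>-by-\<open>k\<close> times \<open>k\<close>-by-\<open>m\<close> product has to obey the bound for square matrices whose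
  size is the largest of the three dimensions (lemma \<open>stable_matmul_pad\<close> below: zero padding
  achieves this). The constant \<open>K\<close> behind \<open>O(\<epsilon>\<^sup>2)\<close> and the range of \<open>\<epsilon>\<close> in which the bound holds
  may depend on the size \<open>N\<close>, but not on the entries of the matrices.\<close>

definition stable_matmul :: "(real \<Rightarrow> real mat \<Rightarrow> real mat \<Rightarrow> real mat) \<Rightarrow> (nat \<Rightarrow> real) \<Rightarrow> bool" where
  "stable_matmul mm \<mu> \<longleftrightarrow>
     (\<forall>N. \<exists>K. \<forall>\<^sub>F \<epsilon> in at_right 0. \<forall>n k m A B.
        max n (max k m) = N \<longrightarrow> A \<in> carrier_mat n k \<longrightarrow> B \<in> carrier_mat k m \<longrightarrow>
        mm \<epsilon> A B \<in> carrier_mat n m \<and>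
        mnorm (mm \<epsilon> A B - A * B) \<le> (\<mu> N * \<epsilon> + K * \<epsilon>\<^sup>2) * (mnorm A * mnorm B))"

definition fl_mat_sub :: "fl_arith \<Rightarrow> real mat \<Rightarrow> real mat \<Rightarrow> real mat" where
  "fl_mat_sub F A B = mat (dim_row A) (dim_col A) (\<lambda>ij. fl_sub F (A $$ ij) (B $$ ij))"

text \<open>2-norm of the first column.\<close>

definition fl_norm :: "fl_arith \<Rightarrow> real mat \<Rightarrow> real" where
  "fl_norm F A = fl_sqrt F (foldl (\<lambda>s i. fl_add F s (fl_mul F (A $$ (i,0)) (A $$ (i,0)))) 0 [0..<dim_row A])"

section \<open>The algorithm\<close>

text \<open>Rows \<open>i\<^sub>0, \<dots>, i\<^sub>1 - 1\<close> and columns \<open>j\<^sub>0, \<dots>, j\<^sub>1 - 1\<close>, counted from 0;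
  thus \<open>A(i\<^sub>0+1:i\<^sub>1, j\<^sub>0+1:j\<^sub>1)\<close> in MATLAB notation.\<close>

definition slice :: "'a mat \<Rightarrow> nat \<Rightarrow> nat \<Rightarrow> nat \<Rightarrow> nat \<Rightarrow> 'a mat" where
  "slice A i\<^sub>0 i\<^sub>1 j\<^sub>0 j\<^sub>1 = mat (i\<^sub>1 - i\<^sub>0) (j\<^sub>1 - j\<^sub>0) (\<lambda>(i,j). A $$ (i\<^sub>0 + i, j\<^sub>0 + j))"

definition append_cols :: "'a::zero mat \<Rightarrow> 'a mat \<Rightarrow> 'a mat" (infixr \<open>@\<^sub>c\<close> 65) where
  "A @\<^sub>c B = (A\<^sup>T @\<^sub>r B\<^sup>T)\<^sup>T"

text \<open>With \<open>x\<close> the given column and \<open>\<sigma>\<close> the sign of \<open>x\<^sub>1\<close>, the Householder vector is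
  \<open>w = v / \<parallel>v\<parallel>\<close> for \<open>v = x + \<sigma> \<parallel>x\<parallel> e\<^sub>1\<close> (the sign choice without cancellation), and
  \<open>(I - 2 w w\<^sup>T) x = - \<sigma> \<parallel>x\<parallel> e\<^sub>1\<close>. For \<open>x = 0\<close> the vector \<open>w = e\<^sub>1\<close> is used.\<close>

definition householder :: "fl_arith \<Rightarrow> real mat \<Rightarrow> real mat \<times> real mat \<times> real mat" where
  "householder F A =
     (let n = dim_row A; a = A $$ (0,0); s = fl_norm F A in
      if s = 0 then
        (0\<^sub>m 1 1,
         mat n 1 (\<lambda>(i,j). if i = 0 then 1 else 0),
         mat 1 n (\<lambda>(i,j). if j = 0 then 2 else 0))
      else
        let v = mat n 1 (\<lambda>(i,j). if i = 0 then (if a < 0 then fl_sub F a s else fl_add F a s)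
                                  else A $$ (i,0));
            t = fl_norm F v;
            W = mat n 1 (\<lambda>(i,j). fl_div F (v $$ (i,0)) t);
            Y = mat 1 n (\<lambda>(i,j). fl_mul F 2 (W $$ (j,0)))
        in (mat 1 1 (\<lambda>_. if a < 0 then s else - s), W, Y))"

function qrr :: "fl_arith \<Rightarrow> (real mat \<Rightarrow> real mat \<Rightarrow> real mat) \<Rightarrow> real mat
    \<Rightarrow> real mat \<times> real mat \<times> real mat" where
  "qrr F mm A =
     (let n = dim_row A; m = dim_col A; p = m div 2; q = m - p in
      if m \<le> 1 then householder F A
      else
        case qrr F mm (slice A 0 n 0 p) of (R\<^sub>L, W\<^sub>L, Y\<^sub>L) \<Rightarrow>
        let A\<^sub>2 = slice A 0 n p m;
            A' = fl_mat_sub F A\<^sub>2 (mm W\<^sub>L (mm Y\<^sub>L A\<^sub>2))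
        in
        case qrr F mm (slice A' p n 0 q) of (R\<^sub>R, W\<^sub>R, Y\<^sub>R) \<Rightarrow>
        let X = fl_mat_sub F W\<^sub>L (0\<^sub>m p p @\<^sub>r mm W\<^sub>R (mm Y\<^sub>R (slice W\<^sub>L p n 0 p)))
        in
          (four_block_mat R\<^sub>L (slice A' 0 p 0 q) (0\<^sub>m q p) R\<^sub>R,
           X @\<^sub>c (0\<^sub>m p q @\<^sub>r W\<^sub>R),
           Y\<^sub>L @\<^sub>r (0\<^sub>m q p @\<^sub>c Y\<^sub>R)))"
  by pat_completeness auto
termination
  by (relation "measure (\<lambda>(F, mm, A). dim_col A)") (auto simp: slice_def)

declare qrr.simps [simp del]

section \<open>Rectangular products from square ones\<close>

text \<open>Not needed for the definitions above: a square multiplication routine with the stability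
  bound yields, by zero padding, one that satisfies \<open>stable_matmul\<close> with the same \<open>\<mu>\<close>.\<close>

definition pad :: "nat \<Rightarrow> real mat \<Rightarrow> real mat" where
  "pad N A = mat N N (\<lambda>(i,j). if i < dim_row A \<and> j < dim_col A then A $$ (i,j) else 0)"

definition pad_mul :: "(real mat \<Rightarrow> real mat \<Rightarrow> real mat) \<Rightarrow> real mat \<Rightarrow> real mat \<Rightarrow> real mat" where
  "pad_mul mm A B =
     (let N = max (dim_row A) (max (dim_col A) (dim_col B))
      in slice (mm (pad N A) (pad N B)) 0 (dim_row A) 0 (dim_col B))"

lemma vnorm_sum: "vnorm x = sqrt (\<Sum>i<dim_vec x. (x $ i)\<^sup>2)"
  by (simp add: vnorm_def scalar_prod_def power2_eq_square atLeast0LessThan)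

lemma abs_le_vnorm: "i < dim_vec x \<Longrightarrow> \<bar>x $ i\<bar> \<le> vnorm x"
proof -
  assume i: "i < dim_vec x"
  have "(x $ i)\<^sup>2 \<le> (\<Sum>i<dim_vec x. (x $ i)\<^sup>2)"
    using i by (intro member_le_sum) auto
  then show ?thesis unfolding vnorm_sum by (metis real_sqrt_abs real_sqrt_le_mono)
qed

lemma vnorm_extend_le:
  assumes "dim_vec x \<le> dim_vec y" "\<And>i. i < dim_vec x \<Longrightarrow> x $ i = y $ i"
  shows "vnorm x \<le> vnorm y"
proof -
  have "(\<Sum>i<dim_vec x. (x $ i)\<^sup>2) = (\<Sum>i<dim_vec x. (y $ i)\<^sup>2)"
    using assms by (intro sum.cong) auto
  also have "\<dots> \<le> (\<Sum>i<dim_vec y. (y $ i)\<^sup>2)"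
    using assms by (intro sum_mono2) auto
  finally show ?thesis unfolding vnorm_sum by simp
qed

lemma vnorm_extend_eq:
  assumes "dim_vec x \<le> dim_vec y" "\<And>i. i < dim_vec x \<Longrightarrow> x $ i = y $ i"
    "\<And>i. dim_vec x \<le> i \<Longrightarrow> i < dim_vec y \<Longrightarrow> y $ i = 0"
  shows "vnorm x = vnorm y"
proof -
  have "(\<Sum>i<dim_vec x. (x $ i)\<^sup>2) = (\<Sum>i<dim_vec x. (y $ i)\<^sup>2)"
    using assms by (intro sum.cong) auto
  also have "\<dots> = (\<Sum>i<dim_vec y. (y $ i)\<^sup>2)"
    using assms by (intro sum.mono_neutral_left) auto
  finally show ?thesis unfolding vnorm_sum by simp
qed

lemma mnorm_bdd: "bdd_above ((\<lambda>x. vnorm (A *\<^sub>v x)) ` {x \<in> carrier_vec (dim_col A). vnorm x \<le> 1})"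
proof (rule bdd_aboveI2)
  fix x assume "x \<in> {x \<in> carrier_vec (dim_col A). vnorm x \<le> 1}"
  then have x: "dim_vec x = dim_col A" "vnorm x \<le> 1" by auto
  have "\<bar>(A *\<^sub>v x) $ i\<bar> \<le> (\<Sum>j<dim_col A. \<bar>A $$ (i,j)\<bar>)" if "i < dim_row A" for i
  proof -
    have "(A *\<^sub>v x) $ i = (\<Sum>j<dim_col A. A $$ (i,j) * x $ j)"
      using that x by (simp add: scalar_prod_def atLeast0LessThan)
    also have "\<bar>\<dots>\<bar> \<le> (\<Sum>j<dim_col A. \<bar>A $$ (i,j) * x $ j\<bar>)" by (rule sum_abs)
    also have "\<dots> \<le> (\<Sum>j<dim_col A. \<bar>A $$ (i,j)\<bar>)"
    proof (rule sum_mono)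
      fix j assume "j \<in> {..<dim_col A}"
      then have "\<bar>x $ j\<bar> \<le> 1" using abs_le_vnorm[of j x] x by auto
      then show "\<bar>A $$ (i,j) * x $ j\<bar> \<le> \<bar>A $$ (i,j)\<bar>" by (simp add: abs_mult mult_left_le)
    qed
    finally show ?thesis .
  qed
  then have "(\<Sum>i<dim_row A. ((A *\<^sub>v x) $ i)\<^sup>2) \<le> (\<Sum>i<dim_row A. (\<Sum>j<dim_col A. \<bar>A $$ (i,j)\<bar>)\<^sup>2)"
    by (intro sum_mono) (metis abs_ge_zero lessThan_iff power2_abs power_mono)
  then show "vnorm (A *\<^sub>v x) \<le> sqrt (\<Sum>i<dim_row A. (\<Sum>j<dim_col A. \<bar>A $$ (i,j)\<bar>)\<^sup>2)"
    unfolding vnorm_sum by simp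
qed

lemma vnorm_zero: "vnorm (0\<^sub>v n) = 0"
  by (simp add: vnorm_def)

lemma mnorm_slice:
  assumes C: "C \<in> carrier_mat N N" and n: "n \<le> N" and m: "m \<le> N"
  shows "mnorm (slice C 0 n 0 m) \<le> mnorm C"
  unfolding mnorm_def
proof (rule cSUP_mono)
  show "{x \<in> carrier_vec (dim_col (slice C 0 n 0 m)). vnorm x \<le> 1} \<noteq> {}"
    by (auto simp: vnorm_zero intro!: exI[of _ "0\<^sub>v _"] zero_carrier_vec)
  show "bdd_above ((\<lambda>x. vnorm (C *\<^sub>v x)) ` {x \<in> carrier_vec (dim_col C). vnorm x \<le> 1})"
    by (rule mnorm_bdd)
  fix x assume "x \<in> {x \<in> carrier_vec (dim_col (slice C 0 n 0 m)). vnorm x \<le> 1}"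
  then have x: "dim_vec x = m" "vnorm x \<le> 1" by (auto simp: slice_def)
  define y where "y = vec N (\<lambda>i. if i < m then x $ i else 0)"
  have "vnorm x = vnorm y" using x m by (intro vnorm_extend_eq) (auto simp: y_def)
  moreover have "vnorm (slice C 0 n 0 m *\<^sub>v x) \<le> vnorm (C *\<^sub>v y)"
  proof (rule vnorm_extend_le)
    fix i assume "i < dim_vec (slice C 0 n 0 m *\<^sub>v x)"
    then have i: "i < n" by (simp add: slice_def)
    have "(slice C 0 n 0 m *\<^sub>v x) $ i = (\<Sum>j<m. C $$ (i,j) * x $ j)"
      using i x by (simp add: slice_def scalar_prod_def atLeast0LessThan)
    also have "\<dots> = (\<Sum>j<m. C $$ (i,j) * y $ j)"
      using m by (intro sum.cong) (auto simp: y_def)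
    also have "\<dots> = (\<Sum>j<N. C $$ (i,j) * y $ j)"
      using m by (intro sum.mono_neutral_left) (auto simp: y_def)
    also have "\<dots> = (C *\<^sub>v y) $ i"
      using i n C by (simp add: y_def scalar_prod_def atLeast0LessThan)
    finally show "(slice C 0 n 0 m *\<^sub>v x) $ i = (C *\<^sub>v y) $ i" .
  qed (use C n in \<open>simp add: slice_def\<close>)
  ultimately show "\<exists>y\<in>{x \<in> carrier_vec (dim_col C). vnorm x \<le> 1}.
      vnorm (slice C 0 n 0 m *\<^sub>v x) \<le> vnorm (C *\<^sub>v y)"
    using x C by (intro bexI[of _ y]) (auto simp: y_def)
qed

lemma slice_pad: "A \<in> carrier_mat n m \<Longrightarrow> n \<le> N \<Longrightarrow> m \<le> N \<Longrightarrow> slice (pad N A) 0 n 0 m = A"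
  by (intro eq_matI) (auto simp: slice_def pad_def)

lemma mnorm_pad:
  assumes A: "A \<in> carrier_mat n m" and n: "n \<le> N" and m: "m \<le> N"
  shows "mnorm (pad N A) = mnorm A"
proof (rule antisym)
  show "mnorm A \<le> mnorm (pad N A)"
    using mnorm_slice[of "pad N A" N n m] slice_pad[OF A n m] n m by (simp add: pad_def)
  show "mnorm (pad N A) \<le> mnorm A"
    unfolding mnorm_def
  proof (rule cSUP_mono)
    show "{x \<in> carrier_vec (dim_col (pad N A)). vnorm x \<le> 1} \<noteq> {}"
      by (auto simp: vnorm_zero intro!: exI[of _ "0\<^sub>v _"] zero_carrier_vec)
    show "bdd_above ((\<lambda>x. vnorm (A *\<^sub>v x)) ` {x \<in> carrier_vec (dim_col A). vnorm x \<le> 1})"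
      by (rule mnorm_bdd)
    fix x assume "x \<in> {x \<in> carrier_vec (dim_col (pad N A)). vnorm x \<le> 1}"
    then have x: "dim_vec x = N" "vnorm x \<le> 1" by (auto simp: pad_def)
    define y where "y = vec m (\<lambda>i. x $ i)"
    have "vnorm y \<le> vnorm x" using x m by (intro vnorm_extend_le) (auto simp: y_def)
    moreover have "vnorm (A *\<^sub>v y) = vnorm (pad N A *\<^sub>v x)"
    proof (rule vnorm_extend_eq)
      fix i assume "i < dim_vec (A *\<^sub>v y)"
      then have i: "i < n" using A by simp
      have "(A *\<^sub>v y) $ i = (\<Sum>j<m. A $$ (i,j) * x $ j)"
        using i A by (simp add: y_def scalar_prod_def atLeast0LessThan)
      also have "\<dots> = (\<Sum>j<m. pad N A $$ (i,j) * x $ j)"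
        using i n m A by (intro sum.cong) (auto simp: pad_def)
      also have "\<dots> = (\<Sum>j<N. pad N A $$ (i,j) * x $ j)"
        using i n m A by (intro sum.mono_neutral_left) (auto simp: pad_def)
      also have "\<dots> = (pad N A *\<^sub>v x) $ i"
        using i n x by (simp add: pad_def scalar_prod_def atLeast0LessThan)
      finally show "(A *\<^sub>v y) $ i = (pad N A *\<^sub>v x) $ i" .
    next
      fix i assume "dim_vec (A *\<^sub>v y) \<le> i" "i < dim_vec (pad N A *\<^sub>v x)"
      then show "(pad N A *\<^sub>v x) $ i = 0"
        using A x by (auto simp: pad_def scalar_prod_def)
    qed (use A n in \<open>simp add: pad_def\<close>)
    ultimately show "\<exists>y\<in>{x \<in> carrier_vec (dim_col A). vnorm x \<le> 1}.
        vnorm (pad N A *\<^sub>v x) \<le> vnorm (A *\<^sub>v y)"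
      using x A by (intro bexI[of _ y]) (auto simp: y_def)
  qed
qed

lemma stable_matmul_pad:
  assumes "\<forall>N. \<exists>K. \<forall>\<^sub>F \<epsilon> in at_right 0. \<forall>A\<in>carrier_mat N N. \<forall>B\<in>carrier_mat N N.
    mm \<epsilon> A B \<in> carrier_mat N N \<and>
    mnorm (mm \<epsilon> A B - A * B) \<le> (\<mu> N * \<epsilon> + K * \<epsilon>\<^sup>2) * (mnorm A * mnorm B)"
  shows "stable_matmul (\<lambda>\<epsilon>. pad_mul (mm \<epsilon>)) \<mu>"
  unfolding stable_matmul_def
proof
  fix N
  obtain K where "\<forall>\<^sub>F \<epsilon> in at_right 0. \<forall>A\<in>carrier_mat N N. \<forall>B\<in>carrier_mat N N.
    mm \<epsilon> A B \<in> carrier_mat N N \<and>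
    mnorm (mm \<epsilon> A B - A * B) \<le> (\<mu> N * \<epsilon> + K * \<epsilon>\<^sup>2) * (mnorm A * mnorm B)"
    using assms by blast
  then have "\<forall>\<^sub>F \<epsilon> in at_right 0. \<forall>n k m A B.
        max n (max k m) = N \<longrightarrow> A \<in> carrier_mat n k \<longrightarrow> B \<in> carrier_mat k m \<longrightarrow>
        pad_mul (mm \<epsilon>) A B \<in> carrier_mat n m \<and>
        mnorm (pad_mul (mm \<epsilon>) A B - A * B) \<le> (\<mu> N * \<epsilon> + K * \<epsilon>\<^sup>2) * (mnorm A * mnorm B)"
  proof (rule eventually_mono, intro allI impI)
    fix \<epsilon> n k m and A B :: "real mat"
    assume *: "\<forall>A\<in>carrier_mat N N. \<forall>B\<in>carrier_mat N N. mm \<epsilon> A B \<in> carrier_mat N N \<and>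
        mnorm (mm \<epsilon> A B - A * B) \<le> (\<mu> N * \<epsilon> + K * \<epsilon>\<^sup>2) * (mnorm A * mnorm B)"
      and N: "max n (max k m) = N" and A: "A \<in> carrier_mat n k" and B: "B \<in> carrier_mat k m"
    have le: "n \<le> N" "k \<le> N" "m \<le> N" using N by auto
    let ?P = "mm \<epsilon> (pad N A) (pad N B)"
    have P: "?P \<in> carrier_mat N N"
      "mnorm (?P - pad N A * pad N B) \<le> (\<mu> N * \<epsilon> + K * \<epsilon>\<^sup>2) * (mnorm A * mnorm B)"
      using *[rule_format, of "pad N A" "pad N B"] mnorm_pad[OF A le(1,2)] mnorm_pad[OF B le(2,3)]
      by (auto simp: pad_def)
    have eq: "pad_mul (mm \<epsilon>) A B = slice ?P 0 n 0 m"
      using A B N by (auto simp: pad_mul_def Let_def)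
    have AB: "(A * B) $$ (i,j) = (pad N A * pad N B) $$ (i,j)" if "i < n" "j < m" for i j
    proof -
      have "(A * B) $$ (i,j) = (\<Sum>l<k. A $$ (i,l) * B $$ (l,j))"
        using that A B by (simp add: scalar_prod_def atLeast0LessThan)
      also have "\<dots> = (\<Sum>l<k. pad N A $$ (i,l) * pad N B $$ (l,j))"
        using that A B le by (intro sum.cong) (auto simp: pad_def)
      also have "\<dots> = (\<Sum>l<N. pad N A $$ (i,l) * pad N B $$ (l,j))"
        using that A B le by (intro sum.mono_neutral_left) (auto simp: pad_def)
      also have "\<dots> = (pad N A * pad N B) $$ (i,j)"
        using that le by (simp add: pad_def scalar_prod_def atLeast0LessThan)
      finally show ?thesis .
    qed
    have "slice ?P 0 n 0 m - A * B = slice (?P - pad N A * pad N B) 0 n 0 m"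
    proof (rule eq_matI)
      fix i j
      assume "i < dim_row (slice (?P - pad N A * pad N B) 0 n 0 m)"
        "j < dim_col (slice (?P - pad N A * pad N B) 0 n 0 m)"
      then have ij: "i < n" "j < m" by (auto simp: slice_def)
      have d: "dim_row (pad N A) = N" "dim_col (pad N B) = N" by (auto simp: pad_def)
      show "(slice ?P 0 n 0 m - A * B) $$ (i,j) = slice (?P - pad N A * pad N B) 0 n 0 m $$ (i,j)"
        using ij A B P(1) le AB[OF ij] d by (simp add: slice_def del: index_mult_mat(1))
    qed (use A B in \<open>auto simp: slice_def\<close>)
    moreover have "mnorm (slice (?P - pad N A * pad N B) 0 n 0 m) \<le> mnorm (?P - pad N A * pad N B)"
      using P(1) le by (intro mnorm_slice[of _ N]) (auto simp: pad_def)
    ultimately show "pad_mul (mm \<epsilon>) A B \<in> carrier_mat n m \<and>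
        mnorm (pad_mul (mm \<epsilon>) A B - A * B) \<le> (\<mu> N * \<epsilon> + K * \<epsilon>\<^sup>2) * (mnorm A * mnorm B)"
      using P(2) eq by (auto simp: slice_def)
  qed
  then show "\<exists>K. \<forall>\<^sub>F \<epsilon> in at_right 0. \<forall>n k m A B.
        max n (max k m) = N \<longrightarrow> A \<in> carrier_mat n k \<longrightarrow> B \<in> carrier_mat k m \<longrightarrow>
        pad_mul (mm \<epsilon>) A B \<in> carrier_mat n m \<and>
        mnorm (pad_mul (mm \<epsilon>) A B - A * B) \<le> (\<mu> N * \<epsilon> + K * \<epsilon>\<^sup>2) * (mnorm A * mnorm B)"
    by blast
qed

end

theory Submission
  imports Defs "HOL-Analysis.L2_Norm" "HOL-Analysis.Convex"
begin

text \<open>The algorithm only ever applies transformations that are, up to rounding, orthogonal, and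
  orthogonal matrices do not amplify errors. This is expressed by comparing the computed
  \<open>I - W Y\<close> at every level of the recursion with an exactly orthogonal matrix \<open>U\<close>
  (which becomes \<open>Q\<^sup>T\<close>), and the computed \<open>[R; 0]\<close> with \<open>U A\<close> (definition \<open>accurate_qr\<close>). For a
  single column, \<open>U\<close> is the reflection for the exact Householder vector (\<open>householder_accurate\<close>). For
  more columns it is \<open>U = diag(I, U\<^sub>R) U\<^sub>L\<close>, with the matrices \<open>U\<^sub>L\<close> and \<open>U\<^sub>R\<close> that belong to the two recursive
  calls (\<open>accurate_qr_step\<close>). To first order in \<open>\<epsilon>\<close> the errors of the two calls are then simply added, and
  the products and subtractions of the step itself contribute a further term of order \<open>n\<^sup>c \<epsilon>\<close>. Since the
  recursion tree has \<open>2 m - 1\<close> nodes, the total is again polynomial in \<open>n\<close> times \<open>\<epsilon>\<close>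
  (\<open>qrr_accurate\<close>); the depth of the recursion does not matter, because to first order no error is multiplied
  by a constant on its way from one level to the next.

  Two further points make this work. The rounding errors of a step are relative to the norms of \<open>W\<close>
  and \<open>Y\<close>, so the induction has to control these too; they grow at most linearly in the number of
  columns. And products of two errors, which are of order \<open>\<epsilon>\<^sup>2\<close> with constants that depend on \<open>n\<close>, are absorbed
  by some slack in the first-order constants, because \<open>\<epsilon>\<close> tends to \<open>0\<close> for fixed \<open>n\<close> (\<open>error_recurrence\<close>).

  All estimates use the Frobenius norm. Like the spectral norm it is submultiplicative and
  invariant under orthogonal factors, but it is in addition monotone in the absolute values of the entries and
  thus compatible with the entrywise rounding model. The two norms differ by a factor of at most
  the square root of the dimension, which is absorbed by \<open>n\<^sup>c\<close>.\<close>

section \<open>The Frobenius norm\<close>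

definition fnorm :: "real mat \<Rightarrow> real" where
  "fnorm A = L2_set (\<lambda>ij. A $$ ij) ({..<dim_row A} \<times> {..<dim_col A})"

lemma fnorm_nonneg [simp]: "0 \<le> fnorm A"
  by (simp add: fnorm_def)

lemma fnorm_power2: "(fnorm A)\<^sup>2 = (\<Sum>i<dim_row A. \<Sum>j<dim_col A. (A $$ (i,j))\<^sup>2)"
  by (simp add: fnorm_def L2_set_def sum_nonneg sum.cartesian_product case_prod_beta)

lemma fnorm_carrier:
  "A \<in> carrier_mat n m \<Longrightarrow> fnorm A = L2_set (\<lambda>ij. A $$ ij) ({..<n} \<times> {..<m})"
  by (simp add: fnorm_def)

lemma fnorm_zero [simp]: "fnorm (0\<^sub>m n m) = 0"
  unfolding fnorm_def by (rule L2_set_0') auto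

lemma fnorm_eq_0D:
  assumes "fnorm A = 0" "A \<in> carrier_mat n m"
  shows "A = 0\<^sub>m n m"
proof (rule eq_matI)
  fix i j assume "i < dim_row (0\<^sub>m n m :: real mat)" "j < dim_col (0\<^sub>m n m :: real mat)"
  then show "A $$ (i,j) = (0\<^sub>m n m :: real mat) $$ (i,j)"
    using assms by (auto simp: fnorm_def L2_set_eq_0_iff)
qed (use assms in auto)

text \<open>This is where the Frobenius norm is better suited than the spectral norm: a rounding model that
bounds every entry relative to its exact value gives the same relative bound for the norm of the
matrix, without a factor that depends on the dimensions.\<close>

lemma fnorm_mono:
  assumes "A \<in> carrier_mat n m" "B \<in> carrier_mat n m"
    "\<And>i j. i < n \<Longrightarrow> j < m \<Longrightarrow> \<bar>A $$ (i,j)\<bar> \<le> c * \<bar>B $$ (i,j)\<bar>" "0 \<le> c"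
  shows "fnorm A \<le> c * fnorm B"
proof -
  have "fnorm A \<le> L2_set (\<lambda>ij. c * \<bar>B $$ ij\<bar>) ({..<n} \<times> {..<m})"
    unfolding fnorm_carrier[OF assms(1)] L2_set_def
    by (rule real_sqrt_le_mono, rule sum_mono)
      (use assms(3,4) in \<open>auto intro!: power_mono simp: power2_le_iff_abs_le abs_mult\<close>)
  also have "\<dots> = c * fnorm B"
    unfolding fnorm_carrier[OF assms(2)] using \<open>0 \<le> c\<close>
    by (subst L2_set_right_distrib[symmetric]) (auto simp: L2_set_def)
  finally show ?thesis .
qed

lemma abs_index_le_fnorm:
  assumes "i < dim_row A" "j < dim_col A"
  shows "\<bar>A $$ (i,j)\<bar> \<le> fnorm A"
proof -
  have "\<bar>A $$ (i,j)\<bar> \<le> L2_set (\<lambda>ij. \<bar>A $$ ij\<bar>) ({..<dim_row A} \<times> {..<dim_col A})"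
    using assms by (intro member_le_L2_set[of _ _ "\<lambda>ij. \<bar>A $$ ij\<bar>", simplified]) auto
  then show ?thesis by (simp add: fnorm_def L2_set_def)
qed

lemma fnorm_add_le:
  assumes "A \<in> carrier_mat n m" "B \<in> carrier_mat n m"
  shows "fnorm (A + B) \<le> fnorm A + fnorm B"
proof -
  have "fnorm (A + B) = L2_set (\<lambda>ij. A $$ ij + B $$ ij) ({..<n} \<times> {..<m})"
    using assms by (subst fnorm_carrier[of _ n m]) (auto intro!: L2_set_cong)
  also have "\<dots> \<le> fnorm A + fnorm B"
    using assms by (simp add: fnorm_carrier L2_set_triangle_ineq)
  finally show ?thesis .
qed

lemma fnorm_smult [simp]: "fnorm (c \<cdot>\<^sub>m A) = \<bar>c\<bar> * fnorm A"
proof -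
  have "(fnorm (c \<cdot>\<^sub>m A))\<^sup>2 = (\<bar>c\<bar> * fnorm A)\<^sup>2"
    by (simp add: fnorm_power2 power_mult_distrib sum_distrib_left)
  then show ?thesis by (simp add: power2_eq_iff_nonneg)
qed

lemma fnorm_uminus [simp]: "fnorm (- A) = fnorm A"
proof -
  have "- A = (- 1) \<cdot>\<^sub>m A" by (intro eq_matI) auto
  then show ?thesis by simp
qed

lemma fnorm_minus_commute:
  assumes "A \<in> carrier_mat n m" "B \<in> carrier_mat n m"
  shows "fnorm (A - B) = fnorm (B - A)"
proof -
  have "B - A = - (A - B)" using assms by (intro eq_matI) auto
  then show ?thesis by simp
qed

lemma fnorm_minus_le:
  assumes "A \<in> carrier_mat n m" "B \<in> carrier_mat n m"
  shows "fnorm (A - B) \<le> fnorm A + fnorm B"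
proof -
  have "A - B = A + (- B)" using assms by (intro eq_matI) auto
  then show ?thesis using fnorm_add_le[of A n m "- B"] assms by simp
qed

lemma fnorm_minus_triangle:
  assumes "A \<in> carrier_mat n m" "B \<in> carrier_mat n m" "C \<in> carrier_mat n m"
  shows "fnorm (A - C) \<le> fnorm (A - B) + fnorm (B - C)"
proof -
  have "A - C = (A - B) + (B - C)" using assms by (intro eq_matI) auto
  then show ?thesis
    using fnorm_add_le[of "A - B" n m "B - C"] assms by (metis minus_carrier_mat)
qed

lemma fnorm_le_add_minus:
  assumes "A \<in> carrier_mat n m" "B \<in> carrier_mat n m"
  shows "fnorm A \<le> fnorm B + fnorm (A - B)"
proof -
  have "A = B + (A - B)" using assms by (intro eq_matI) auto
  then show ?thesis using fnorm_add_le[of B n m "A - B"] assms by (metis minus_carrier_mat)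
qed

lemma abs_fnorm_minus_le:
  assumes "A \<in> carrier_mat n m" "B \<in> carrier_mat n m"
  shows "\<bar>fnorm A - fnorm B\<bar> \<le> fnorm (A - B)"
  using fnorm_le_add_minus[OF assms] fnorm_le_add_minus[OF assms(2,1)] fnorm_minus_commute[OF assms]
  by linarith

lemma fnorm_transpose [simp]: "fnorm A\<^sup>T = fnorm A"
proof -
  have "(fnorm A\<^sup>T)\<^sup>2 = (fnorm A)\<^sup>2"
    unfolding fnorm_power2 by (subst sum.swap) simp
  then show ?thesis by (simp add: power2_eq_iff_nonneg)
qed

text \<open>Cauchy-Schwarz, applied to the row and the column that define each entry of the product.\<close>

lemma fnorm_mult_le:
  assumes A: "A \<in> carrier_mat n k" and B: "B \<in> carrier_mat k m"
  shows "fnorm (A * B) \<le> fnorm A * fnorm B"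
proof (rule power2_le_imp_le)
  have "(fnorm (A * B))\<^sup>2 = (\<Sum>i<n. \<Sum>j<m. (\<Sum>l<k. A $$ (i,l) * B $$ (l,j))\<^sup>2)"
    using A B by (simp add: fnorm_power2 scalar_prod_def atLeast0LessThan)
  also have "\<dots> \<le> (\<Sum>i<n. \<Sum>j<m. (\<Sum>l<k. (A $$ (i,l))\<^sup>2) * (\<Sum>l<k. (B $$ (l,j))\<^sup>2))"
    by (intro sum_mono Cauchy_Schwarz_ineq_sum)
  also have "\<dots> = (\<Sum>i<n. \<Sum>l<k. (A $$ (i,l))\<^sup>2) * (\<Sum>j<m. \<Sum>l<k. (B $$ (l,j))\<^sup>2)"
    by (simp add: sum_product)
  also have "(\<Sum>j<m. \<Sum>l<k. (B $$ (l,j))\<^sup>2) = (\<Sum>l<k. \<Sum>j<m. (B $$ (l,j))\<^sup>2)"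
    by (rule sum.swap)
  finally show "(fnorm (A * B))\<^sup>2 \<le> (fnorm A * fnorm B)\<^sup>2"
    using A B by (simp add: fnorm_power2 power_mult_distrib)
qed simp

subsection \<open>Comparison with the spectral norm\<close>

lemma vnorm_mult_le_fnorm:
  assumes x: "x \<in> carrier_vec (dim_col A)" "vnorm x \<le> 1"
  shows "vnorm (A *\<^sub>v x) \<le> fnorm A"
proof (rule power2_le_imp_le)
  have v2: "(vnorm y)\<^sup>2 = (\<Sum>i<dim_vec y. (y $ i)\<^sup>2)" for y
    by (simp add: vnorm_sum sum_nonneg)
  have "0 \<le> vnorm x" by (simp add: vnorm_sum sum_nonneg)
  then have x2: "(\<Sum>j<dim_col A. (x $ j)\<^sup>2) \<le> 1"
    using x v2[of x] power_le_one[of "vnorm x" 2] by simp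
  have "(vnorm (A *\<^sub>v x))\<^sup>2 = (\<Sum>i<dim_row A. (\<Sum>j<dim_col A. A $$ (i,j) * x $ j)\<^sup>2)"
    using x by (simp add: v2 scalar_prod_def atLeast0LessThan)
  also have "\<dots> \<le> (\<Sum>i<dim_row A. (\<Sum>j<dim_col A. (A $$ (i,j))\<^sup>2) * (\<Sum>j<dim_col A. (x $ j)\<^sup>2))"
    by (intro sum_mono Cauchy_Schwarz_ineq_sum)
  also have "\<dots> \<le> (\<Sum>i<dim_row A. (\<Sum>j<dim_col A. (A $$ (i,j))\<^sup>2) * 1)"
    by (intro sum_mono mult_left_mono x2 sum_nonneg) auto
  finally show "(vnorm (A *\<^sub>v x))\<^sup>2 \<le> (fnorm A)\<^sup>2" by (simp add: fnorm_power2)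
qed simp

lemma mnorm_le_fnorm: "mnorm A \<le> fnorm A"
  unfolding mnorm_def
proof (rule cSUP_least)
  show "{x \<in> carrier_vec (dim_col A). vnorm x \<le> 1} \<noteq> {}"
    by (auto simp: vnorm_zero intro!: exI[of _ "0\<^sub>v _"] zero_carrier_vec)
qed (auto intro: vnorm_mult_le_fnorm)

lemma vnorm_mult_le_mnorm:
  "x \<in> carrier_vec (dim_col A) \<Longrightarrow> vnorm x \<le> 1 \<Longrightarrow> vnorm (A *\<^sub>v x) \<le> mnorm A"
  unfolding mnorm_def by (rule cSUP_upper[OF _ mnorm_bdd]) auto

lemma mnorm_nonneg: "0 \<le> mnorm A"
proof -
  have "0 \<le> vnorm (A *\<^sub>v 0\<^sub>v (dim_col A))" by (simp add: vnorm_sum sum_nonneg)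
  also have "\<dots> \<le> mnorm A" by (rule vnorm_mult_le_mnorm) (auto simp: vnorm_zero)
  finally show ?thesis .
qed

text \<open>Every column of \<open>A\<close> is the image of a unit vector, so each of them contributes at most
\<open>(mnorm A)\<^sup>2\<close> to the sum of squares.\<close>

lemma fnorm_le_mnorm: "fnorm A \<le> sqrt (real (dim_col A)) * mnorm A"
proof (rule power2_le_imp_le)
  have col: "(\<Sum>i<dim_row A. (A $$ (i,j))\<^sup>2) \<le> (mnorm A)\<^sup>2" if j: "j < dim_col A" for j
  proof -
    have "vnorm (unit_vec (dim_col A) j) = 1"
      using j by (simp add: vnorm_def)
    then have "vnorm (A *\<^sub>v unit_vec (dim_col A) j) \<le> mnorm A"
      by (intro vnorm_mult_le_mnorm) auto
    then have "(vnorm (A *\<^sub>v unit_vec (dim_col A) j))\<^sup>2 \<le> (mnorm A)\<^sup>2"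
      by (intro power_mono) (auto simp: vnorm_sum sum_nonneg)
    moreover have "(vnorm (A *\<^sub>v unit_vec (dim_col A) j))\<^sup>2 = (\<Sum>i<dim_row A. (A $$ (i,j))\<^sup>2)"
      using j by (simp add: vnorm_sum sum_nonneg)
    ultimately show ?thesis by simp
  qed
  have "(fnorm A)\<^sup>2 = (\<Sum>j<dim_col A. \<Sum>i<dim_row A. (A $$ (i,j))\<^sup>2)"
    unfolding fnorm_power2 by (rule sum.swap)
  also have "\<dots> \<le> (\<Sum>j<dim_col A. (mnorm A)\<^sup>2)"
    by (intro sum_mono col) auto
  finally show "(fnorm A)\<^sup>2 \<le> (sqrt (real (dim_col A)) * mnorm A)\<^sup>2"
    by (simp add: power_mult_distrib)
qed (simp add: mnorm_nonneg)

section \<open>Orthogonal matrices\<close>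

text \<open>Each of the two identities gives invariance of the norm on one side: \<open>U\<^sup>T U = I\<close> for multiplication by
\<open>U\<close> from the left, \<open>U U\<^sup>T = I\<close> from the right.\<close>

definition orthogonal_mat :: "nat \<Rightarrow> real mat \<Rightarrow> bool" where
  "orthogonal_mat n U \<longleftrightarrow> U \<in> carrier_mat n n \<and> U * U\<^sup>T = 1\<^sub>m n \<and> U\<^sup>T * U = 1\<^sub>m n"

lemma orthogonal_matD:
  assumes "orthogonal_mat n U"
  shows "U \<in> carrier_mat n n" "U * U\<^sup>T = 1\<^sub>m n" "U\<^sup>T * U = 1\<^sub>m n"
  using assms by (auto simp: orthogonal_mat_def)

lemma orthogonal_mat_transpose: "orthogonal_mat n U \<Longrightarrow> orthogonal_mat n U\<^sup>T"
  by (auto simp: orthogonal_mat_def)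

lemma orthogonal_mat_mult:
  assumes "orthogonal_mat n U" "orthogonal_mat n V"
  shows "orthogonal_mat n (U * V)"
proof -
  note U = orthogonal_matD[OF assms(1)] and V = orthogonal_matD[OF assms(2)]
  have t: "(U * V)\<^sup>T = V\<^sup>T * U\<^sup>T" using U(1) V(1) by (rule transpose_mult)
  have "(U * V) * (V\<^sup>T * U\<^sup>T) = U * ((V * V\<^sup>T) * U\<^sup>T)"
    using U(1) V(1) by (simp add: assoc_mult_mat[of _ n n _ n _ n])
  moreover have "(V\<^sup>T * U\<^sup>T) * (U * V) = V\<^sup>T * ((U\<^sup>T * U) * V)"
    using U(1) V(1) by (simp add: assoc_mult_mat[of _ n n _ n _ n])
  ultimately show ?thesis
    unfolding orthogonal_mat_def t using U V by simp
qed

text \<open>The squared norm is the trace of the Gram matrix, which an orthogonal factor on the left leaves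
unchanged.\<close>

lemma fnorm_power2_gram:
  assumes "A \<in> carrier_mat n m"
  shows "(fnorm A)\<^sup>2 = (\<Sum>j<m. (A\<^sup>T * A) $$ (j,j))"
  using assms unfolding fnorm_power2
  by (subst sum.swap) (simp add: scalar_prod_def power2_eq_square atLeast0LessThan)

lemma fnorm_orthogonal_mult:
  assumes U: "orthogonal_mat n U" and A: "A \<in> carrier_mat n m"
  shows "fnorm (U * A) = fnorm A"
proof -
  note Ud = orthogonal_matD[OF U]
  have "(U * A)\<^sup>T * (U * A) = A\<^sup>T * ((U\<^sup>T * U) * A)"
    using Ud(1) A by (subst transpose_mult[OF Ud(1) A])
      (simp add: assoc_mult_mat[of _ m n _ n _ m] assoc_mult_mat[of _ n n _ n _ m])
  also have "\<dots> = A\<^sup>T * A" using Ud A by simp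
  finally have "(fnorm (U * A))\<^sup>2 = (fnorm A)\<^sup>2"
    using fnorm_power2_gram[OF A] fnorm_power2_gram[of "U * A" n m] Ud(1) A by simp
  then show ?thesis by (simp add: power2_eq_iff_nonneg)
qed

lemma fnorm_mult_orthogonal:
  assumes U: "orthogonal_mat n U" and A: "A \<in> carrier_mat m n"
  shows "fnorm (A * U) = fnorm A"
proof -
  have "fnorm (A * U) = fnorm (U\<^sup>T * A\<^sup>T)"
    using fnorm_transpose[of "A * U"] transpose_mult[OF A orthogonal_matD(1)[OF U]] by simp
  also have "\<dots> = fnorm A"
    using fnorm_orthogonal_mult[OF orthogonal_mat_transpose[OF U], of "A\<^sup>T" m] A by simp
  finally show ?thesis .
qed

section \<open>Block matrices\<close>

lemma dim_append_rows [simp]: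
  "dim_row (A @\<^sub>r B) = dim_row A + dim_row B" "dim_col (A @\<^sub>r B) = dim_col A"
  by (auto simp: append_rows_def)

lemma dim_append_cols [simp]:
  "dim_row (A @\<^sub>c B) = dim_row A" "dim_col (A @\<^sub>c B) = dim_col A + dim_col B"
  by (auto simp: append_cols_def)

lemma carrier_append_cols [simp, intro]:
  "A \<in> carrier_mat n m1 \<Longrightarrow> B \<in> carrier_mat n m2 \<Longrightarrow> A @\<^sub>c B \<in> carrier_mat n (m1 + m2)"
  by auto

lemma index_append_rows:
  "i < dim_row A + dim_row B \<Longrightarrow> j < dim_col A \<Longrightarrow>
    (A @\<^sub>r B) $$ (i,j) = (if i < dim_row A then A $$ (i,j) else B $$ (i - dim_row A, j))"
  by (auto simp: append_rows_def)

lemma index_append_cols: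
  "i < dim_row A \<Longrightarrow> dim_row B = dim_row A \<Longrightarrow> j < dim_col A + dim_col B \<Longrightarrow>
    (A @\<^sub>c B) $$ (i,j) = (if j < dim_col A then A $$ (i,j) else B $$ (i, j - dim_col A))"
  by (auto simp: append_cols_def index_append_rows)

lemma slice_carrier [simp]: "slice A i\<^sub>0 i\<^sub>1 j\<^sub>0 j\<^sub>1 \<in> carrier_mat (i\<^sub>1 - i\<^sub>0) (j\<^sub>1 - j\<^sub>0)"
  by (simp add: slice_def)

lemma dim_slice [simp]:
  "dim_row (slice A i\<^sub>0 i\<^sub>1 j\<^sub>0 j\<^sub>1) = i\<^sub>1 - i\<^sub>0" "dim_col (slice A i\<^sub>0 i\<^sub>1 j\<^sub>0 j\<^sub>1) = j\<^sub>1 - j\<^sub>0"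
  by (simp_all add: slice_def)

lemma index_slice [simp]:
  "i < i\<^sub>1 - i\<^sub>0 \<Longrightarrow> j < j\<^sub>1 - j\<^sub>0 \<Longrightarrow> slice A i\<^sub>0 i\<^sub>1 j\<^sub>0 j\<^sub>1 $$ (i,j) = A $$ (i\<^sub>0 + i, j\<^sub>0 + j)"
  by (simp add: slice_def)

lemma append_cols_slice:
  "A \<in> carrier_mat n m \<Longrightarrow> p \<le> m \<Longrightarrow> slice A 0 n 0 p @\<^sub>c slice A 0 n p m = A"
  by (intro eq_matI) (auto simp: index_append_cols)

lemma append_rows_slice:
  "A \<in> carrier_mat n m \<Longrightarrow> p \<le> n \<Longrightarrow> slice A 0 p 0 m @\<^sub>r slice A p n 0 m = A"
  by (intro eq_matI) (auto simp: index_append_rows)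

lemma fnorm_append_rows:
  assumes "A \<in> carrier_mat r1 m" "B \<in> carrier_mat r2 m"
  shows "(fnorm (A @\<^sub>r B))\<^sup>2 = (fnorm A)\<^sup>2 + (fnorm B)\<^sup>2"
proof -
  let ?f = "\<lambda>i. \<Sum>j<m. ((A @\<^sub>r B) $$ (i,j))\<^sup>2"
  have "(fnorm (A @\<^sub>r B))\<^sup>2 = (\<Sum>i<r1 + r2. ?f i)"
    using assms by (simp add: fnorm_power2)
  also have "\<dots> = (\<Sum>i<r1. ?f i) + (\<Sum>i<r2. ?f (r1 + i))"
    by (induction r2) (auto simp: algebra_simps)
  also have "(\<Sum>i<r1. ?f i) = (fnorm A)\<^sup>2"
    using assms unfolding fnorm_power2 by (intro sum.cong) (auto simp: index_append_rows)
  also have "(\<Sum>i<r2. ?f (r1 + i)) = (fnorm B)\<^sup>2"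
    using assms unfolding fnorm_power2 by (intro sum.cong) (auto simp: index_append_rows)
  finally show ?thesis .
qed

lemma fnorm_append_rows_le:
  assumes "A \<in> carrier_mat r1 m" "B \<in> carrier_mat r2 m"
  shows "fnorm (A @\<^sub>r B) \<le> fnorm A + fnorm B"
  by (rule power2_le_imp_le) (simp_all add: fnorm_append_rows[OF assms] power2_sum)

lemma fnorm_append_cols_le:
  assumes "A \<in> carrier_mat n m1" "B \<in> carrier_mat n m2"
  shows "fnorm (A @\<^sub>c B) \<le> fnorm A + fnorm B"
  using fnorm_append_rows_le[of "A\<^sup>T" m1 n "B\<^sup>T" m2] assms
  by (simp add: append_cols_def)

lemma fnorm_zero_append_rows:
  assumes "B \<in> carrier_mat r m"
  shows "fnorm (0\<^sub>m k m @\<^sub>r B) = fnorm B"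
proof -
  have "(fnorm (0\<^sub>m k m @\<^sub>r B))\<^sup>2 = (fnorm B)\<^sup>2"
    using fnorm_append_rows[of "0\<^sub>m k m" k m B r] assms by simp
  then show ?thesis by (simp add: power2_eq_iff_nonneg)
qed

lemma fnorm_zero_append_cols:
  assumes "B \<in> carrier_mat n m"
  shows "fnorm (0\<^sub>m n k @\<^sub>c B) = fnorm B"
  using fnorm_zero_append_rows[of "B\<^sup>T" m n k] assms by (simp add: append_cols_def)

lemma fnorm_slice_le:
  assumes A: "A \<in> carrier_mat n m" and le: "i\<^sub>1 \<le> n" "j\<^sub>1 \<le> m"
  shows "fnorm (slice A i\<^sub>0 i\<^sub>1 j\<^sub>0 j\<^sub>1) \<le> fnorm A"
proof (rule power2_le_imp_le)
  let ?I = "{..<i\<^sub>1 - i\<^sub>0} \<times> {..<j\<^sub>1 - j\<^sub>0}" and ?h = "\<lambda>(i,j). (i\<^sub>0 + i, j\<^sub>0 + j)"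
  have "(fnorm (slice A i\<^sub>0 i\<^sub>1 j\<^sub>0 j\<^sub>1))\<^sup>2 = (\<Sum>ij\<in>?I. (A $$ ?h ij)\<^sup>2)"
    unfolding fnorm_def L2_set_def by (auto simp: sum_nonneg intro!: sum.cong)
  also have "\<dots> = (\<Sum>ij\<in>?h ` ?I. (A $$ ij)\<^sup>2)"
    by (subst sum.reindex) (auto simp: inj_on_def)
  also have "\<dots> \<le> (\<Sum>ij\<in>{..<n} \<times> {..<m}. (A $$ ij)\<^sup>2)"
    using le by (intro sum_mono2) auto
  also have "\<dots> = (fnorm A)\<^sup>2"
    using A by (simp add: fnorm_def L2_set_def sum_nonneg)
  finally show "(fnorm (slice A i\<^sub>0 i\<^sub>1 j\<^sub>0 j\<^sub>1))\<^sup>2 \<le> (fnorm A)\<^sup>2" .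
qed simp

lemma mult_append_cols:
  assumes "A \<in> carrier_mat n k" "B \<in> carrier_mat k m1" "C \<in> carrier_mat k m2"
  shows "A * (B @\<^sub>c C) = (A * B) @\<^sub>c (A * C)"
proof (rule eq_matI)
  fix i j assume "i < dim_row ((A * B) @\<^sub>c (A * C))" "j < dim_col ((A * B) @\<^sub>c (A * C))"
  then show "(A * (B @\<^sub>c C)) $$ (i,j) = ((A * B) @\<^sub>c (A * C)) $$ (i,j)"
    using assms by (auto simp: index_append_cols scalar_prod_def)
qed (use assms in auto)

lemma append_rows_mult:
  assumes "A \<in> carrier_mat r1 k" "B \<in> carrier_mat r2 k" "C \<in> carrier_mat k m"
  shows "(A @\<^sub>r B) * C = (A * C) @\<^sub>r (B * C)"
proof (rule eq_matI)
  fix i j assume "i < dim_row ((A * C) @\<^sub>r (B * C))" "j < dim_col ((A * C) @\<^sub>r (B * C))"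
  then show "((A @\<^sub>r B) * C) $$ (i,j) = ((A * C) @\<^sub>r (B * C)) $$ (i,j)"
    using assms by (auto simp: index_append_rows scalar_prod_def)
qed (use assms in auto)

lemma append_cols_mult_append_rows:
  assumes "A \<in> carrier_mat n k1" "B \<in> carrier_mat n k2" "C \<in> carrier_mat k1 m" "D \<in> carrier_mat k2 m"
  shows "(A @\<^sub>c B) * (C @\<^sub>r D) = A * C + B * D"
proof (rule eq_matI)
  fix i j assume "i < dim_row (A * C + B * D)" "j < dim_col (A * C + B * D)"
  then have ij: "i < n" "j < m" using assms by auto
  let ?f = "\<lambda>l. (A @\<^sub>c B) $$ (i,l) * (C @\<^sub>r D) $$ (l,j)"
  have "((A @\<^sub>c B) * (C @\<^sub>r D)) $$ (i,j) = (\<Sum>l<k1 + k2. ?f l)"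
    using ij assms by (simp add: scalar_prod_def atLeast0LessThan)
  also have "\<dots> = (\<Sum>l<k1. ?f l) + (\<Sum>l<k2. ?f (k1 + l))"
    by (induction k2) (auto simp: algebra_simps)
  also have "(\<Sum>l<k1. ?f l) = (A * C) $$ (i,j)"
    using ij assms by (simp add: scalar_prod_def atLeast0LessThan index_append_rows index_append_cols)
  also have "(\<Sum>l<k2. ?f (k1 + l)) = (B * D) $$ (i,j)"
    using ij assms by (simp add: scalar_prod_def atLeast0LessThan index_append_rows index_append_cols)
  finally show "((A @\<^sub>c B) * (C @\<^sub>r D)) $$ (i,j) = (A * C + B * D) $$ (i,j)"
    using ij assms by simp
qed (use assms in auto)

section \<open>Rounding errors of the elementary steps\<close>

lemma standard_modelD:
  assumes "standard_model \<epsilon> F"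
  shows "\<bar>fl_add F x y - (x + y)\<bar> \<le> \<epsilon> * \<bar>x + y\<bar>"
    "\<bar>fl_sub F x y - (x - y)\<bar> \<le> \<epsilon> * \<bar>x - y\<bar>"
    "\<bar>fl_mul F x y - x * y\<bar> \<le> \<epsilon> * \<bar>x * y\<bar>"
    "y \<noteq> 0 \<Longrightarrow> \<bar>fl_div F x y - x / y\<bar> \<le> \<epsilon> * \<bar>x / y\<bar>"
    "0 \<le> x \<Longrightarrow> \<bar>fl_sqrt F x - sqrt x\<bar> \<le> \<epsilon> * sqrt x"
  using assms unfolding standard_model_def by auto

lemma fl_mat_sub_carrier [simp]:
  "A \<in> carrier_mat n m \<Longrightarrow> fl_mat_sub F A B \<in> carrier_mat n m"
  by (simp add: fl_mat_sub_def)

lemma fnorm_fl_mat_sub: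
  assumes F: "standard_model \<epsilon> F" "0 \<le> \<epsilon>"
    and AB: "A \<in> carrier_mat n m" "B \<in> carrier_mat n m"
  shows "fnorm (fl_mat_sub F A B - (A - B)) \<le> \<epsilon> * fnorm (A - B)"
  by (rule fnorm_mono[of _ n m])
    (use AB F(2) standard_modelD(2)[OF F(1)] in \<open>auto simp: fl_mat_sub_def\<close>)

text \<open>In the algorithm the matrix that is subtracted is itself a computed quantity \<open>B'\<close>, whereas the
result has to be compared with the difference for the exact \<open>B\<close>.\<close>

lemma fnorm_fl_mat_sub_perturbed:
  assumes F: "standard_model \<epsilon> F" "0 \<le> \<epsilon>"
    and car: "A \<in> carrier_mat n m" "B \<in> carrier_mat n m" "B' \<in> carrier_mat n m"
    and \<theta>: "fnorm (B' - B) \<le> \<theta>"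
  shows "fnorm (fl_mat_sub F A B' - (A - B)) \<le> \<epsilon> * (fnorm A + fnorm B + \<theta>) + \<theta>"
proof -
  have B': "fnorm B' \<le> fnorm B + \<theta>"
    using fnorm_le_add_minus[OF car(3,2)] \<theta> by simp
  have "fnorm (fl_mat_sub F A B' - (A - B))
      \<le> fnorm (fl_mat_sub F A B' - (A - B')) + fnorm ((A - B') - (A - B))"
    by (rule fnorm_minus_triangle[of _ n m]) (use car in auto)
  also have "(A - B') - (A - B) = - (B' - B)" using car by (intro eq_matI) auto
  also have "fnorm (fl_mat_sub F A B' - (A - B')) \<le> \<epsilon> * fnorm (A - B')"
    by (rule fnorm_fl_mat_sub[OF F car(1,3)])
  also have "fnorm (A - B') \<le> fnorm A + fnorm B + \<theta>"
    using fnorm_minus_le[OF car(1,3)] B' by simp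
  finally show ?thesis using F(2) \<theta> by (simp add: mult_left_mono)
qed

text \<open>The stability bound for one fixed machine epsilon and all sizes up to \<open>N\<close>, with a single
factor \<open>\<delta>\<close> that is going to be a multiple of \<open>\<epsilon>\<close>: for fixed \<open>N\<close> and small \<open>\<epsilon>\<close> the quadratic
term of the first-order bound is dominated by \<open>\<epsilon>\<close>.\<close>

definition accurate_matmul :: "real \<Rightarrow> nat \<Rightarrow> (real mat \<Rightarrow> real mat \<Rightarrow> real mat) \<Rightarrow> bool" where
  "accurate_matmul \<delta> N mm \<longleftrightarrow>
     (\<forall>n k m A B. n \<le> N \<longrightarrow> k \<le> N \<longrightarrow> m \<le> N \<longrightarrow> A \<in> carrier_mat n k \<longrightarrow> B \<in> carrier_mat k m \<longrightarrow>
        mm A B \<in> carrier_mat n m \<and> fnorm (mm A B - A * B) \<le> \<delta> * (fnorm A * fnorm B))"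

lemma accurate_matmulD:
  assumes "accurate_matmul \<delta> N mm" "n \<le> N" "k \<le> N" "m \<le> N"
    "A \<in> carrier_mat n k" "B \<in> carrier_mat k m"
  shows "mm A B \<in> carrier_mat n m" "fnorm (mm A B - A * B) \<le> \<delta> * (fnorm A * fnorm B)"
  using assms unfolding accurate_matmul_def by blast+

text \<open>The inner product contributes \<open>\<delta>\<close>; the outer one contributes \<open>\<delta>\<close> relative to the computed inner
product, whose norm is at most \<open>1 + \<delta> \<le> 2\<close> times the bound for the exact one.\<close>

lemma accurate_matmul_twice:
  assumes mm: "accurate_matmul \<delta> N mm" "0 \<le> \<delta>" "\<delta> \<le> 1"
    and le: "n \<le> N" "k \<le> N" "l \<le> N" "m \<le> N"
    and car: "W \<in> carrier_mat n k" "Y \<in> carrier_mat k l" "B \<in> carrier_mat l m"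
  shows "mm W (mm Y B) \<in> carrier_mat n m"
    "fnorm (mm W (mm Y B) - W * (Y * B)) \<le> 3 * \<delta> * (fnorm W * fnorm Y * fnorm B)"
proof -
  note YB = accurate_matmulD[OF mm(1) le(2,3,4) car(2,3)]
  note W = accurate_matmulD[OF mm(1) le(1,2,4) car(1) YB(1)]
  show "mm W (mm Y B) \<in> carrier_mat n m" by (rule W(1))
  have n2: "fnorm (mm Y B) \<le> 2 * (fnorm Y * fnorm B)"
  proof -
    have "fnorm (mm Y B) \<le> fnorm (Y * B) + fnorm (mm Y B - Y * B)"
      by (rule fnorm_le_add_minus[of _ k m]) (use YB(1) car in auto)
    also have "\<dots> \<le> fnorm Y * fnorm B + \<delta> * (fnorm Y * fnorm B)"
      by (intro add_mono fnorm_mult_le[OF car(2,3)] YB(2))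
    also have "\<dots> \<le> 2 * (fnorm Y * fnorm B)"
      using mult_right_mono[OF mm(3), of "fnorm Y * fnorm B"] by (simp add: mult.commute)
    finally show ?thesis .
  qed
  have "fnorm (mm W (mm Y B) - W * (Y * B))
      \<le> fnorm (mm W (mm Y B) - W * mm Y B) + fnorm (W * mm Y B - W * (Y * B))"
    by (rule fnorm_minus_triangle[of _ n m]) (use W(1) YB(1) car in auto)
  also have "W * mm Y B - W * (Y * B) = W * (mm Y B - Y * B)"
    using YB(1) car by (intro mult_minus_distrib_mat[symmetric]) auto
  also have "fnorm (mm W (mm Y B) - W * mm Y B) \<le> \<delta> * (fnorm W * (2 * (fnorm Y * fnorm B)))"
    by (rule order_trans[OF W(2)]) (intro mult_left_mono n2 mm(2) fnorm_nonneg)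
  also have "fnorm (W * (mm Y B - Y * B)) \<le> fnorm W * (\<delta> * (fnorm Y * fnorm B))"
    by (rule order_trans[OF fnorm_mult_le[of _ n k _ m]])
      (use YB car in \<open>auto intro!: mult_left_mono minus_carrier_mat\<close>)
  finally show "fnorm (mm W (mm Y B) - W * (Y * B)) \<le> 3 * \<delta> * (fnorm W * fnorm Y * fnorm B)"
    by (simp add: algebra_simps)
qed

section \<open>Householder reflections\<close>

lemma fnorm_column: "A \<in> carrier_mat n 1 \<Longrightarrow> (fnorm A)\<^sup>2 = (\<Sum>i<n. (A $$ (i,0))\<^sup>2)"
  by (simp add: fnorm_power2)

text \<open>The square root does not amplify a relative error, because
\<open>(sqrt t - sqrt s) * (sqrt t + sqrt s) = t - s\<close> and the second factor is at least \<open>sqrt s\<close>.\<close>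

lemma sqrt_relative_error:
  assumes "0 \<le> s" "0 \<le> t" "\<bar>t - s\<bar> \<le> \<theta> * s"
  shows "\<bar>sqrt t - sqrt s\<bar> \<le> \<theta> * sqrt s"
proof (cases "s = 0")
  case False
  then have s: "0 < sqrt s" using assms(1) by simp
  have "\<bar>sqrt t - sqrt s\<bar> * sqrt s \<le> \<bar>sqrt t - sqrt s\<bar> * (sqrt t + sqrt s)"
    using assms by (intro mult_left_mono) auto
  also have "\<dots> = \<bar>(sqrt t - sqrt s) * (sqrt t + sqrt s)\<bar>"
    using assms by (simp add: abs_mult)
  also have "(sqrt t - sqrt s) * (sqrt t + sqrt s) = t - s"
    using assms by (simp add: algebra_simps)
  also have "\<bar>t - s\<bar> \<le> (\<theta> * sqrt s) * sqrt s" using assms by (simp add: mult.assoc)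
  finally show ?thesis using s by simp
qed (use assms in auto)

text \<open>All summands are nonnegative, so relative errors do not get amplified by cancellation. Each step
adds at most \<open>3 * \<epsilon>\<close> to the relative error: \<open>\<epsilon>\<close> for the rounded square and \<open>2 * \<epsilon>\<close> for the
rounded addition, whose computed argument is at most twice the exact partial sum.\<close>

lemma fl_sum_squares_error:
  assumes F: "standard_model \<epsilon> F" "0 \<le> \<epsilon>" and small: "3 * real k * \<epsilon> \<le> 1"
  shows "\<bar>foldl (\<lambda>s i. fl_add F s (fl_mul F (x i) (x i))) 0 [0..<k] - (\<Sum>i<k. (x i)\<^sup>2)\<bar>
    \<le> 3 * real k * \<epsilon> * (\<Sum>i<k. (x i)\<^sup>2)"
  using small
proof (induction k)
  case (Suc k)
  let ?s = "foldl (\<lambda>s i. fl_add F s (fl_mul F (x i) (x i))) 0 [0..<k]"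
  let ?S = "\<Sum>i<k. (x i)\<^sup>2" and ?b = "fl_mul F (x k) (x k)" and ?a = "(x k)\<^sup>2"
  define K where "K = 3 * real k * \<epsilon>"
  have K: "0 \<le> K" "K \<le> 1" and \<epsilon>1: "\<epsilon> \<le> 1"
    using Suc.prems F(2) by (auto simp: K_def algebra_simps intro: order_trans[rotated])
  have S: "0 \<le> ?S" by (simp add: sum_nonneg)
  have s: "\<bar>?s - ?S\<bar> \<le> K * ?S" using Suc.IH K(2) by (simp add: K_def)
  have b: "\<bar>?b - ?a\<bar> \<le> \<epsilon> * ?a"
    using standard_modelD(3)[OF F(1), of "x k" "x k"] by (simp add: power2_eq_square)
  have "\<bar>?s + ?b\<bar> \<le> (1 + K) * ?S + (1 + \<epsilon>) * ?a"
    using s b S by (simp add: algebra_simps) (smt (verit) zero_le_power2)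
  also have "\<dots> \<le> 2 * ?S + 2 * ?a"
    using S K \<epsilon>1 by (intro add_mono mult_right_mono) auto
  finally have "\<epsilon> * \<bar>?s + ?b\<bar> \<le> \<epsilon> * (2 * ?S + 2 * ?a)" using F(2) by (rule mult_left_mono)
  then have "\<bar>fl_add F ?s ?b - (?S + ?a)\<bar> \<le> \<epsilon> * (2 * ?S + 2 * ?a) + K * ?S + \<epsilon> * ?a"
    using standard_modelD(1)[OF F(1), of ?s ?b] s b by linarith
  also have "\<dots> \<le> (K + 3 * \<epsilon>) * (?S + ?a)"
    using S K F(2) mult_nonneg_nonneg[OF F(2) S] mult_nonneg_nonneg[OF K(1), of ?a]
    by (simp add: algebra_simps)
  finally show ?case by (simp add: K_def algebra_simps)
qed simp

text \<open>The sum of squares contributes \<open>3 * n * \<epsilon>\<close>, and the rounded square root at most \<open>2 * \<epsilon>\<close>, as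
the root of the computed sum is at most twice the exact norm.\<close>

lemma fl_norm_error:
  assumes F: "standard_model \<epsilon> F" "0 \<le> \<epsilon>" and small: "3 * real n * \<epsilon> \<le> 1"
    and A: "A \<in> carrier_mat n 1" and n: "1 \<le> n"
  shows "\<bar>fl_norm F A - fnorm A\<bar> \<le> 5 * real n * \<epsilon> * fnorm A"
proof -
  let ?t = "foldl (\<lambda>s i. fl_add F s (fl_mul F (A $$ (i,0)) (A $$ (i,0)))) 0 [0..<n]"
  let ?S = "\<Sum>i<n. (A $$ (i,0))\<^sup>2" and ?K = "3 * real n * \<epsilon>"
  have S: "0 \<le> ?S" "sqrt ?S = fnorm A"
    using fnorm_column[OF A] by (auto simp: sum_nonneg real_sqrt_unique)
  have err: "\<bar>?t - ?S\<bar> \<le> ?K * ?S"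
    by (rule fl_sum_squares_error[OF F small])
  moreover have "?K * ?S \<le> 1 * ?S" using S(1) small by (intro mult_right_mono) auto
  ultimately have t: "0 \<le> ?t" by linarith
  have r: "\<bar>sqrt ?t - fnorm A\<bar> \<le> ?K * fnorm A"
    using sqrt_relative_error[OF S(1) t err] S(2) by simp
  moreover have "\<bar>fl_norm F A - sqrt ?t\<bar> \<le> \<epsilon> * sqrt ?t"
    using standard_modelD(5)[OF F(1) t] A by (simp add: fl_norm_def)
  moreover have "\<epsilon> * sqrt ?t \<le> \<epsilon> * (2 * fnorm A)"
  proof -
    have "?K * fnorm A \<le> 1 * fnorm A" using small by (intro mult_right_mono) auto
    then show ?thesis using r F(2) by (intro mult_left_mono) auto
  qed
  moreover have "2 * \<epsilon> * fnorm A \<le> 2 * real n * \<epsilon> * fnorm A"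
    using n F(2) by (intro mult_right_mono) (auto simp: mult_le_cancel_right1)
  ultimately show ?thesis by (simp add: algebra_simps)
qed

definition reflector :: "real mat \<Rightarrow> real mat" where
  "reflector w = 1\<^sub>m (dim_row w) - 2 \<cdot>\<^sub>m (w * w\<^sup>T)"

text \<open>For a unit vector \<open>w\<close> the matrix \<open>P = w w\<^sup>T\<close> is a symmetric projection, and
\<open>(I - 2 P)\<^sup>2 = I - 4 P + 4 P\<^sup>2 = I\<close>.\<close>

lemma orthogonal_reflector:
  assumes w: "w \<in> carrier_mat n 1" and unit: "fnorm w = 1"
  shows "orthogonal_mat n (reflector w)"
proof -
  let ?P = "w * w\<^sup>T"
  have P: "?P \<in> carrier_mat n n" using w by auto
  have sym: "(reflector w)\<^sup>T = reflector w"
    using w by (intro eq_matI) (auto simp: reflector_def scalar_prod_def mult.commute)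
  have "w\<^sup>T * w = 1\<^sub>m 1"
    using fnorm_column[OF w] unit w
    by (intro eq_matI) (auto simp: scalar_prod_def power2_eq_square atLeast0LessThan)
  then have PP: "?P * ?P = ?P"
    using w by (simp add: assoc_mult_mat[of _ n 1 _ n _ n] assoc_mult_mat[of _ 1 n _ 1 _ n, symmetric])
  have "reflector w * reflector w = (1\<^sub>m n - 2 \<cdot>\<^sub>m ?P) * (1\<^sub>m n - 2 \<cdot>\<^sub>m ?P)"
    using w by (simp add: reflector_def)
  also have "\<dots> = 1\<^sub>m n * (1\<^sub>m n - 2 \<cdot>\<^sub>m ?P) - (2 \<cdot>\<^sub>m ?P) * (1\<^sub>m n - 2 \<cdot>\<^sub>m ?P)"
    by (rule minus_mult_distrib_mat[where nr = n and nc = n]) (use P w in \<open>auto intro!: minus_carrier_mat\<close>)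
  also have "(2 \<cdot>\<^sub>m ?P) * (1\<^sub>m n - 2 \<cdot>\<^sub>m ?P) = (2 \<cdot>\<^sub>m ?P) * 1\<^sub>m n - (2 \<cdot>\<^sub>m ?P) * (2 \<cdot>\<^sub>m ?P)"
    by (rule mult_minus_distrib_mat[where nr = n and nc = n]) (use P in auto)
  also have "(2 \<cdot>\<^sub>m ?P) * (2 \<cdot>\<^sub>m ?P) = 2 \<cdot>\<^sub>m (2 \<cdot>\<^sub>m ?P)"
    using P PP by (simp add: mult_smult_distrib[of _ n n _ n] mult_smult_assoc_mat[of _ n n _ n])
  also have "1\<^sub>m n * (1\<^sub>m n - 2 \<cdot>\<^sub>m ?P) - ((2 \<cdot>\<^sub>m ?P) * 1\<^sub>m n - 2 \<cdot>\<^sub>m (2 \<cdot>\<^sub>m ?P)) = 1\<^sub>m n"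
    using w P by (intro eq_matI) (auto simp del: index_mult_mat(1))
  finally show ?thesis
    using w sym by (auto simp: orthogonal_mat_def reflector_def)
qed

text \<open>\<open>W Y - 2 w w\<^sup>T = (W - w) Y + w (Y - 2 w\<^sup>T)\<close>.\<close>

lemma reflector_perturbation:
  assumes w: "w \<in> carrier_mat n 1" and unit: "fnorm w = 1"
    and W: "W \<in> carrier_mat n 1" "fnorm (W - w) \<le> a"
    and Y: "Y \<in> carrier_mat 1 n" "fnorm (Y - 2 \<cdot>\<^sub>m w\<^sup>T) \<le> b"
  shows "fnorm (reflector w - (1\<^sub>m n - W * Y)) \<le> a * fnorm Y + b"
proof -
  have eq: "reflector w - (1\<^sub>m n - W * Y) = (W - w) * Y + w * (Y - 2 \<cdot>\<^sub>m w\<^sup>T)"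
    using w W(1) Y(1) by (intro eq_matI) (auto simp: reflector_def scalar_prod_def algebra_simps)
  have "fnorm (reflector w - (1\<^sub>m n - W * Y)) \<le> fnorm ((W - w) * Y) + fnorm (w * (Y - 2 \<cdot>\<^sub>m w\<^sup>T))"
    unfolding eq by (rule fnorm_add_le[of _ n n]) (use w W Y in auto)
  also have "\<dots> \<le> fnorm (W - w) * fnorm Y + fnorm w * fnorm (Y - 2 \<cdot>\<^sub>m w\<^sup>T)"
    by (intro add_mono fnorm_mult_le[of _ n 1 _ n]) (use w W Y in auto)
  also have "\<dots> \<le> a * fnorm Y + b"
    using W(2) Y(2) unit by (intro add_mono mult_right_mono) auto
  finally show ?thesis .
qed

lemma index_reflector_mult:
  assumes w: "w \<in> carrier_mat n 1" and x: "x \<in> carrier_mat n 1" and i: "i < n"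
  shows "(reflector w * x) $$ (i,0) = x $$ (i,0) - 2 * w $$ (i,0) * (\<Sum>k<n. w $$ (k,0) * x $$ (k,0))"
proof -
  have "(reflector w * x) $$ (i,0)
      = (\<Sum>k<n. (if i = k then x $$ (k,0) else 0) - 2 * w $$ (i,0) * (w $$ (k,0) * x $$ (k,0)))"
    using assms by (auto simp: reflector_def scalar_prod_def atLeast0LessThan algebra_simps intro!: sum.cong)
  also have "\<dots> = x $$ (i,0) - 2 * w $$ (i,0) * (\<Sum>k<n. w $$ (k,0) * x $$ (k,0))"
    using i by (simp add: sum_subtractf sum_distrib_left)
  finally show ?thesis .
qed

text \<open>For \<open>v = x + \<sigma> \<parallel>x\<parallel> e\<^sub>1\<close> one has \<open>v\<^sup>T v = 2 v\<^sup>T x\<close>. Hence the reflection along \<open>v\<close> subtracts exactly \<open>v\<close>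
from \<open>x\<close>, which leaves \<open>- \<sigma> \<parallel>x\<parallel> e\<^sub>1\<close>.\<close>

lemma reflector_householder_vector:
  assumes x: "x \<in> carrier_mat n 1" and v: "v \<in> carrier_mat n 1" and n: "1 \<le> n"
    and \<sigma>: "\<sigma> * \<sigma> = 1"
    and vx: "\<And>i. i < n \<Longrightarrow> v $$ (i,0) = x $$ (i,0) + (if i = 0 then \<sigma> * fnorm x else 0)"
    and nz: "fnorm v \<noteq> 0" and i: "i < n"
  shows "(reflector ((1 / fnorm v) \<cdot>\<^sub>m v) * x) $$ (i,0) = (if i = 0 then - \<sigma> * fnorm x else 0)"
proof -
  \<comment> \<open>The contribution of \<open>\<sigma> \<parallel>x\<parallel> e\<^sub>1\<close> to the terms of \<open>v\<^sup>T x\<close>.\<close>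
  let ?g = "\<lambda>k. if k = 0 then \<sigma> * fnorm x * x $$ (0,0) else 0"
  have d: "(\<Sum>k<n. ?g k) = \<sigma> * fnorm x * x $$ (0,0)" using n by simp
  have "(\<Sum>k<n. v $$ (k,0) * x $$ (k,0)) = (\<Sum>k<n. (x $$ (k,0))\<^sup>2 + ?g k)"
    using vx by (intro sum.cong) (auto simp: algebra_simps power2_eq_square)
  also have "\<dots> = (fnorm x)\<^sup>2 + \<sigma> * fnorm x * x $$ (0,0)"
    by (simp add: sum.distrib d fnorm_column[OF x])
  finally have vdotx: "(\<Sum>k<n. v $$ (k,0) * x $$ (k,0)) = (fnorm x)\<^sup>2 + \<sigma> * fnorm x * x $$ (0,0)" .
  have "(fnorm v)\<^sup>2 = (\<Sum>k<n. (x $$ (k,0))\<^sup>2 + (2 * ?g k + (if k = 0 then (fnorm x)\<^sup>2 else 0)))"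
    unfolding fnorm_column[OF v] using vx \<sigma>
    by (intro sum.cong) (auto simp: algebra_simps power2_eq_square)
  also have "\<dots> = 2 * (\<Sum>k<n. v $$ (k,0) * x $$ (k,0))"
    unfolding vdotx using n by (simp add: sum.distrib sum_distrib_left[symmetric] d fnorm_column[OF x])
  finally have vv: "(fnorm v)\<^sup>2 = 2 * (\<Sum>k<n. v $$ (k,0) * x $$ (k,0))" .
  have "(reflector ((1 / fnorm v) \<cdot>\<^sub>m v) * x) $$ (i,0)
      = x $$ (i,0) - v $$ (i,0) * (2 * (\<Sum>k<n. v $$ (k,0) * x $$ (k,0))) / (fnorm v)\<^sup>2"
    using v x i by (subst index_reflector_mult[of _ n])
      (auto simp: sum_distrib_left[symmetric] sum_divide_distrib[symmetric] power2_eq_square)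
  also have "\<dots> = x $$ (i,0) - v $$ (i,0)"
    unfolding vv[symmetric] using nz by simp
  finally show ?thesis using vx[OF i] by simp
qed

text \<open>The forward form of the error statement. The witness \<open>U\<close> is the exactly orthogonal matrix
\<open>Q\<^sup>T\<close>. The residual \<open>U * A - [R; 0]\<close> is measured instead of a perturbation of \<open>A\<close>, because residuals
are what the recursion adds up; since \<open>U\<close> is orthogonal, the two have the same size.\<close>

definition accurate_qr :: "real \<Rightarrow> real \<Rightarrow> real mat \<Rightarrow> real mat \<Rightarrow> real mat \<Rightarrow> real mat \<Rightarrow> bool" where
  "accurate_qr e f A R W Y \<longleftrightarrow> (\<exists>U. orthogonal_mat (dim_row A) U \<and>
     fnorm (U - (1\<^sub>m (dim_row A) - W * Y)) \<le> e \<and>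
     fnorm (U * A - (R @\<^sub>r 0\<^sub>m (dim_row A - dim_col A) (dim_col A))) \<le> f * fnorm A)"

text \<open>The vectors \<open>v' / t\<close> and \<open>v / \<parallel>v\<parallel>\<close> differ by the error \<open>2 * \<eta>\<close> of the vector and the error
\<open>4 * \<eta>\<close> of its norm, both relative to \<open>\<parallel>v\<parallel>\<close>, divided by a \<open>t\<close> that is at least \<open>3 / 4 * \<parallel>v\<parallel>\<close>.\<close>

lemma normalisation_error:
  fixes \<eta> :: real
  assumes v: "v \<in> carrier_mat n m" and v': "v' \<in> carrier_mat n m" and pos: "0 < fnorm v"
    and dv: "fnorm (v' - v) \<le> 2 * \<eta> * fnorm v" and t: "\<bar>t - fnorm v'\<bar> \<le> \<eta> * fnorm v'"
    and \<eta>: "0 \<le> \<eta>" "\<eta> \<le> 1 / 32"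
  shows "0 < t" "fnorm ((1 / t) \<cdot>\<^sub>m v' - (1 / fnorm v) \<cdot>\<^sub>m v) \<le> 8 * \<eta>"
proof -
  let ?c = "fnorm v"
  have v'2: "\<bar>fnorm v' - ?c\<bar> \<le> 2 * \<eta> * ?c" using abs_fnorm_minus_le[OF v' v] dv by simp
  have "\<eta> * ?c \<le> 1 / 32 * ?c" using \<eta>(2) pos by (intro mult_right_mono) auto
  then have "fnorm v' \<le> 2 * ?c" using v'2 pos by linarith
  then have "\<eta> * fnorm v' \<le> \<eta> * (2 * ?c)" using \<eta>(1) by (rule mult_left_mono)
  then have tc: "\<bar>t - ?c\<bar> \<le> 4 * \<eta> * ?c" using t v'2 by linarith
  have t34: "3 / 4 * ?c \<le> t" using tc \<open>\<eta> * ?c \<le> 1 / 32 * ?c\<close> pos by linarith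
  then show tpos: "0 < t" using pos by linarith
  have "(1 / t) \<cdot>\<^sub>m v' - (1 / ?c) \<cdot>\<^sub>m v = (1 / t) \<cdot>\<^sub>m (v' - v) + (1 / t - 1 / ?c) \<cdot>\<^sub>m v"
    using v v' by (intro eq_matI) (auto simp: algebra_simps)
  then have "fnorm ((1 / t) \<cdot>\<^sub>m v' - (1 / ?c) \<cdot>\<^sub>m v) \<le> fnorm ((1 / t) \<cdot>\<^sub>m (v' - v)) + fnorm ((1 / t - 1 / ?c) \<cdot>\<^sub>m v)"
    using fnorm_add_le[of "(1 / t) \<cdot>\<^sub>m (v' - v)" n m "(1 / t - 1 / ?c) \<cdot>\<^sub>m v"] v v'
    by (simp add: minus_carrier_mat)
  also have "\<dots> = (fnorm (v' - v) + \<bar>t - ?c\<bar>) / t"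
  proof -
    have "1 / t - 1 / ?c = - ((t - ?c) / (t * ?c))" using tpos pos by (simp add: field_simps)
    then have "\<bar>1 / t - 1 / ?c\<bar> * ?c = \<bar>t - ?c\<bar> / t"
      using tpos pos by (simp add: abs_mult abs_divide)
    then show ?thesis using tpos by (simp add: add_divide_distrib)
  qed
  also have "\<dots> \<le> (6 * \<eta> * ?c) / t"
    using dv tc tpos by (intro divide_right_mono) auto
  also have "\<dots> \<le> (6 * \<eta> * ?c) / (3 / 4 * ?c)"
    using t34 pos tpos \<eta>(1) by (intro divide_left_mono) auto
  also have "\<dots> = 8 * \<eta>" using pos by simp
  finally show "fnorm ((1 / t) \<cdot>\<^sub>m v' - (1 / ?c) \<cdot>\<^sub>m v) \<le> 8 * \<eta>" .
qed

text \<open>The orthogonal witness is the reflection for the exact Householder vector \<open>v\<close> of the column. The sign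
in \<open>v\<close> is chosen so that its first entry \<open>\<bar>a\<bar> + \<parallel>A\<parallel>\<close> is a sum of nonnegative numbers up to sign;
therefore the relative error \<open>\<eta>\<close> of the computed norm becomes a relative error of \<open>v\<close> of the same
order, and then of \<open>W\<close> and \<open>Y\<close>. The residual is only the error of the norm itself, which appears
as the entry of \<open>R\<close>.\<close>

lemma householder_accurate:
  assumes F: "standard_model \<epsilon> F" "0 \<le> \<epsilon>" and small: "160 * real n * \<epsilon> \<le> 1"
    and A: "A \<in> carrier_mat n 1" and n: "1 \<le> n"
    and res: "householder F A = (R, W, Y)"
  shows "R \<in> carrier_mat 1 1 \<and> W \<in> carrier_mat n 1 \<and> Y \<in> carrier_mat 1 n \<and>
    fnorm W \<le> 2 \<and> fnorm Y \<le> 3 \<and> accurate_qr (270 * real n * \<epsilon>) (5 * real n * \<epsilon>) A R W Y"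
proof -
  define \<eta> where "\<eta> = 5 * real n * \<epsilon>"
  have \<eta>: "0 \<le> \<eta>" "\<eta> \<le> 1 / 32" using F(2) small by (auto simp: \<eta>_def)
  \<comment> \<open>A single rounding costs at most \<open>\<eta> / 5\<close>, so that all errors below are multiples of \<open>\<eta>\<close>.\<close>
  have \<epsilon>\<eta>: "5 * \<epsilon> \<le> \<eta>"
    using n F(2) mult_right_mono[of 1 "real n" "5 * \<epsilon>"] by (simp add: \<eta>_def)
  have norm_err: "\<bar>fl_norm F B - fnorm B\<bar> \<le> \<eta> * fnorm B" if "B \<in> carrier_mat n 1" for B
    unfolding \<eta>_def using small F(2) by (intro fl_norm_error[OF F _ that n]) (auto simp: algebra_simps)
  define s where "s = fl_norm F A"
  define a where "a = A $$ (0,0)"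
  have s: "\<bar>s - fnorm A\<bar> \<le> \<eta> * fnorm A" unfolding s_def by (rule norm_err[OF A])
  have s32: "\<eta> * fnorm A \<le> 1 / 32 * fnorm A" using \<eta>(2) by (intro mult_right_mono) auto
  show ?thesis
  \<comment> \<open>The computed norm vanishes only for the zero column, and then nothing is rounded.\<close>
  proof (cases "s = 0")
    case True
    then have "fnorm A = 0" using s s32 fnorm_nonneg[of A] by linarith
    then have A0: "A = 0\<^sub>m n 1" using A by (rule fnorm_eq_0D)
    have R: "R = 0\<^sub>m 1 1" and W: "W = mat n 1 (\<lambda>(i,j). if i = 0 then 1 else 0)"
      and Y: "Y = mat 1 n (\<lambda>(i,j). if j = 0 then 2 else 0)"
      using res True A by (auto simp: householder_def Let_def s_def)
    have Wc: "W \<in> carrier_mat n 1" and Yc: "Y \<in> carrier_mat 1 n" by (auto simp: W Y)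
    have "(fnorm W)\<^sup>2 = (\<Sum>i<n. if i = 0 then 1 else 0)"
      unfolding fnorm_column[OF Wc] by (intro sum.cong) (auto simp: W)
    then have unit: "fnorm W = 1" using n by (simp add: power2_eq_1_iff) (smt (verit) fnorm_nonneg)
    have YW: "Y = 2 \<cdot>\<^sub>m W\<^sup>T" by (intro eq_matI) (auto simp: W Y)
    have U: "orthogonal_mat n (reflector W)" by (rule orthogonal_reflector[OF Wc unit])
    have "fnorm (W - W) = 0" "fnorm (Y - 2 \<cdot>\<^sub>m W\<^sup>T) = 0"
      using Wc Yc by (auto simp: YW[symmetric])
    then have "fnorm (reflector W - (1\<^sub>m n - W * Y)) \<le> 0 * fnorm Y + 0"
      by (intro reflector_perturbation[OF Wc unit Wc _ Yc]) auto
    also have "0 * fnorm Y + 0 \<le> 270 * real n * \<epsilon>" using F(2) by simp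
    finally have "fnorm (reflector W - (1\<^sub>m n - W * Y)) \<le> 270 * real n * \<epsilon>" .
    moreover have "reflector W * A - (R @\<^sub>r 0\<^sub>m (n - 1) 1) = 0\<^sub>m n 1"
      using n Wc by (intro eq_matI) (auto simp: A0 R index_append_rows reflector_def)
    ultimately have "accurate_qr (270 * real n * \<epsilon>) (5 * real n * \<epsilon>) A R W Y"
      unfolding accurate_qr_def using U A F(2)
      by (intro exI[of _ "reflector W"]) (auto simp: orthogonal_mat_def)
    then show ?thesis using R Wc Yc unit by (auto simp: YW)
  next
    case False
    have pos: "0 < fnorm A"
    proof (rule ccontr)
      assume "\<not> 0 < fnorm A"
      then have "fnorm A = 0" using fnorm_nonneg[of A] by linarith
      then show False using s False by simp
    qed
    define \<sigma> :: real where "\<sigma> = (if a < 0 then - 1 else 1)"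
    define v where "v = mat n 1 (\<lambda>(i,j). A $$ (i,0) + (if i = 0 then \<sigma> * fnorm A else 0))"
    define v' where "v' = mat n 1 (\<lambda>(i,j). if i = 0 then (if a < 0 then fl_sub F a s else fl_add F a s)
                                  else A $$ (i,0))"
    define t where "t = fl_norm F v'"
    define w where "w = (1 / fnorm v) \<cdot>\<^sub>m v"
    have eq: "(R, W, Y) = (mat 1 1 (\<lambda>_. if a < 0 then s else - s),
        mat n 1 (\<lambda>(i,j). fl_div F (v' $$ (i,0)) t),
        mat 1 n (\<lambda>(i,j). fl_mul F 2 (mat n 1 (\<lambda>(i,j). fl_div F (v' $$ (i,0)) t) $$ (j,0))))"
      unfolding res[symmetric] householder_def Let_def v'_def t_def a_def s_def
      using False A by (simp add: s_def)
    then have R: "R = mat 1 1 (\<lambda>_. if a < 0 then s else - s)"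
      and W: "W = mat n 1 (\<lambda>(i,j). fl_div F (v' $$ (i,0)) t)"
      by (simp_all only: prod.inject)
    have Y: "Y = mat 1 n (\<lambda>(i,j). fl_mul F 2 (W $$ (j,0)))"
      using eq W by (simp only: prod.inject)
    have vc: "v \<in> carrier_mat n 1" and v'c: "v' \<in> carrier_mat n 1" and wc: "w \<in> carrier_mat n 1"
      and Wc: "W \<in> carrier_mat n 1" and Yc: "Y \<in> carrier_mat 1 n"
      by (auto simp: v_def v'_def w_def W Y)
    have v0: "\<bar>v $$ (0,0)\<bar> = \<bar>a\<bar> + fnorm A" using n pos by (auto simp: v_def a_def \<sigma>_def)
    have vpos: "0 < fnorm v" using abs_index_le_fnorm[of 0 v 0] v0 pos n vc by auto
    have v'0: "\<bar>v' $$ (0,0) - v $$ (0,0)\<bar> \<le> 2 * \<eta> * \<bar>v $$ (0,0)\<bar>"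
    proof -
      have "\<bar>v' $$ (0,0) - (a + \<sigma> * s)\<bar> \<le> \<epsilon> * \<bar>a + \<sigma> * s\<bar>"
        using n standard_modelD(1)[OF F(1), of a s] standard_modelD(2)[OF F(1), of a s]
        by (auto simp: v'_def \<sigma>_def)
      moreover have "\<epsilon> * \<bar>a + \<sigma> * s\<bar> \<le> \<epsilon> * (2 * (\<bar>a\<bar> + fnorm A))"
        using s s32 F(2) by (intro mult_left_mono) (auto simp: \<sigma>_def)
      moreover have "\<epsilon> * (2 * (\<bar>a\<bar> + fnorm A)) \<le> \<eta> / 5 * (2 * (\<bar>a\<bar> + fnorm A))"
        using \<epsilon>\<eta> by (intro mult_right_mono) auto
      moreover have "v $$ (0,0) = a + \<sigma> * fnorm A" using n by (simp add: v_def a_def)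
      moreover have "\<bar>\<sigma> * s - \<sigma> * fnorm A\<bar> \<le> \<eta> * (\<bar>a\<bar> + fnorm A)"
      proof -
        have "\<bar>\<sigma> * s - \<sigma> * fnorm A\<bar> = \<bar>s - fnorm A\<bar>" by (auto simp: \<sigma>_def)
        then show ?thesis using s mult_nonneg_nonneg[OF \<eta>(1), of "\<bar>a\<bar>"] by (simp add: distrib_left)
      qed
      ultimately have "\<bar>v' $$ (0,0) - v $$ (0,0)\<bar> \<le> \<eta> / 5 * (2 * (\<bar>a\<bar> + fnorm A)) + \<eta> * (\<bar>a\<bar> + fnorm A)"
        by linarith
      also have "\<dots> \<le> 2 * \<eta> * (\<bar>a\<bar> + fnorm A)"
        using mult_nonneg_nonneg[OF \<eta>(1), of "\<bar>a\<bar> + fnorm A"] by (simp add: algebra_simps)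
      finally show ?thesis by (simp add: v0)
    qed
    have dv: "fnorm (v' - v) \<le> 2 * \<eta> * fnorm v"
    proof (rule fnorm_mono[of _ n 1])
      fix i j :: nat assume "i < n" "j < 1"
      then show "\<bar>(v' - v) $$ (i,j)\<bar> \<le> 2 * \<eta> * \<bar>v $$ (i,j)\<bar>"
        using v'0 vc v'c \<eta>(1) by (cases "i = 0") (auto simp: v_def v'_def)
    qed (use vc v'c \<eta> in auto)
    note nrm = normalisation_error[OF vc v'c vpos dv _ \<eta>, of t]
    have tpos: "0 < t" and wt: "fnorm ((1 / t) \<cdot>\<^sub>m v' - w) \<le> 8 * \<eta>"
      using nrm norm_err[OF v'c] by (auto simp: t_def w_def)
    have unit: "fnorm w = 1" using vpos by (simp add: w_def)
    have u2: "fnorm ((1 / t) \<cdot>\<^sub>m v') \<le> 2"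
      using fnorm_le_add_minus[of "(1 / t) \<cdot>\<^sub>m v'" n 1 w] v'c wc wt unit \<eta>(2) by auto
    have "fnorm (W - (1 / t) \<cdot>\<^sub>m v') \<le> \<epsilon> * fnorm ((1 / t) \<cdot>\<^sub>m v')"
      by (rule fnorm_mono[of _ n 1])
        (use Wc v'c F(2) tpos standard_modelD(4)[OF F(1), of t] in \<open>auto simp: W\<close>)
    also have "\<dots> \<le> \<epsilon> * 2" using u2 F(2) by (intro mult_left_mono) auto
    finally have Ww: "fnorm (W - w) \<le> 10 * \<eta>"
      using fnorm_minus_triangle[of W n 1 "(1 / t) \<cdot>\<^sub>m v'" w] Wc v'c wc wt \<epsilon>\<eta> F(2) by auto
    have W2: "fnorm W \<le> 2" using fnorm_le_add_minus[OF Wc wc] Ww unit \<eta>(2) by linarith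
    have "fnorm (Y - 2 \<cdot>\<^sub>m W\<^sup>T) \<le> \<epsilon> * fnorm (2 \<cdot>\<^sub>m W\<^sup>T)"
      by (rule fnorm_mono[of _ 1 n])
        (use Wc Yc F(2) standard_modelD(3)[OF F(1), of 2] in \<open>auto simp: Y\<close>)
    also have "\<dots> \<le> \<epsilon> * 4" using W2 F(2) by (intro mult_left_mono) auto
    finally have YW: "fnorm (Y - 2 \<cdot>\<^sub>m W\<^sup>T) \<le> \<epsilon> * 4" .
    have "2 \<cdot>\<^sub>m W\<^sup>T - 2 \<cdot>\<^sub>m w\<^sup>T = 2 \<cdot>\<^sub>m (W - w)\<^sup>T"
      using Wc wc by (intro eq_matI) auto
    then have "fnorm (2 \<cdot>\<^sub>m W\<^sup>T - 2 \<cdot>\<^sub>m w\<^sup>T) \<le> 20 * \<eta>" using Ww by simp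
    with YW have Yw: "fnorm (Y - 2 \<cdot>\<^sub>m w\<^sup>T) \<le> 21 * \<eta>"
      using fnorm_minus_triangle[of Y 1 n "2 \<cdot>\<^sub>m W\<^sup>T" "2 \<cdot>\<^sub>m w\<^sup>T"] Wc Yc wc \<epsilon>\<eta> F(2) by auto
    have Y3: "fnorm Y \<le> 3"
      using fnorm_le_add_minus[of Y 1 n "2 \<cdot>\<^sub>m w\<^sup>T"] Yc wc Yw unit \<eta>(2) by auto
    have "fnorm (reflector w - (1\<^sub>m n - W * Y)) \<le> 10 * \<eta> * fnorm Y + 21 * \<eta>"
      by (rule reflector_perturbation[OF wc unit Wc Ww Yc Yw])
    also have "\<dots> \<le> 10 * \<eta> * 3 + 21 * \<eta>" using Y3 \<eta>(1) by (intro add_mono mult_left_mono) auto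
    finally have UWY: "fnorm (reflector w - (1\<^sub>m n - W * Y)) \<le> 270 * real n * \<epsilon>"
      using \<eta>(1) unfolding \<eta>_def by argo
    define D where "D = reflector w * A - (R @\<^sub>r 0\<^sub>m (n - 1) 1)"
    have Dc: "D \<in> carrier_mat n 1" using A wc n by (auto simp: D_def reflector_def R)
    have "D $$ (i,0) = (if i = 0 then \<sigma> * (s - fnorm A) else 0)" if i: "i < n" for i
    proof -
      have "(reflector w * A) $$ (i,0) = (if i = 0 then - \<sigma> * fnorm A else 0)"
        unfolding w_def using vpos
        by (intro reflector_householder_vector[OF A vc n _ _ _ i]) (auto simp: \<sigma>_def v_def)
      then show ?thesis
        using i n by (auto simp: D_def R index_append_rows \<sigma>_def algebra_simps simp del: index_mult_mat(1))
    qed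
    then have "(fnorm D)\<^sup>2 = (\<Sum>i<n. if i = 0 then (s - fnorm A)\<^sup>2 else 0)"
      unfolding fnorm_column[OF Dc] by (intro sum.cong) (auto simp: \<sigma>_def power2_commute)
    also have "\<dots> = \<bar>s - fnorm A\<bar>\<^sup>2" using n by simp
    finally have "fnorm D = \<bar>s - fnorm A\<bar>" by (rule power2_eq_imp_eq) auto
    then have "fnorm D \<le> 5 * real n * \<epsilon> * fnorm A" using s by (simp add: \<eta>_def)
    then have "accurate_qr (270 * real n * \<epsilon>) (5 * real n * \<epsilon>) A R W Y"
      unfolding accurate_qr_def using orthogonal_reflector[OF wc unit] UWY A
      by (intro exI[of _ "reflector w"]) (auto simp: D_def)
    then show ?thesis using Wc Yc W2 Y3 by (simp add: R)
  qed
qed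

section \<open>One step of the recursion\<close>

text \<open>The block diagonal matrix with blocks \<open>I\<^sub>p\<close> and \<open>U\<close>: the way in which the transformation of the
trailing rows acts on all rows.\<close>

definition extend_id :: "nat \<Rightarrow> real mat \<Rightarrow> real mat" where
  "extend_id p U = four_block_mat (1\<^sub>m p) (0\<^sub>m p (dim_col U)) (0\<^sub>m (dim_row U) p) U"

lemma extend_id_carrier [simp]:
  "U \<in> carrier_mat r r \<Longrightarrow> extend_id p U \<in> carrier_mat (p + r) (p + r)"
  by (simp add: extend_id_def)

lemma extend_id_mult:
  assumes "U \<in> carrier_mat r r" "V \<in> carrier_mat r r"
  shows "extend_id p U * extend_id p V = extend_id p (U * V)"
  using assms unfolding extend_id_def
  by (subst mult_four_block_mat[of _ p p _ r _ r _ _ p _ r]) auto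

lemma orthogonal_extend_id:
  assumes "orthogonal_mat r U"
  shows "orthogonal_mat (p + r) (extend_id p U)"
proof -
  note U = orthogonal_matD[OF assms]
  have t: "(extend_id p U)\<^sup>T = extend_id p U\<^sup>T"
    unfolding extend_id_def using U(1) by (subst transpose_four_block_mat[of _ p p _ r _ r]) auto
  have "extend_id p (1\<^sub>m r) = 1\<^sub>m (p + r)" by (simp add: extend_id_def)
  then show ?thesis
    using U by (simp add: orthogonal_mat_def t extend_id_mult)
qed

lemma extend_id_append_rows:
  assumes "U \<in> carrier_mat r r" "A \<in> carrier_mat p m" "B \<in> carrier_mat r m"
  shows "extend_id p U * (A @\<^sub>r B) = A @\<^sub>r (U * B)"
  using assms unfolding extend_id_def append_rows_def
  by (subst mult_four_block_mat[of _ p p _ r _ r _ _ m _ 0]) auto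

lemma fnorm_extend_id_minus:
  assumes "U \<in> carrier_mat r r" "V \<in> carrier_mat r r"
  shows "fnorm (extend_id p U - extend_id p V) = fnorm (U - V)"
proof -
  have UV: "U - V \<in> carrier_mat r r" using assms by auto
  have "extend_id p U - extend_id p V = 0\<^sub>m p (p + r) @\<^sub>r (0\<^sub>m r p @\<^sub>c (U - V))"
    using assms by (intro eq_matI) (auto simp: extend_id_def index_append_rows index_append_cols)
  then show ?thesis
    using fnorm_zero_append_rows[of "0\<^sub>m r p @\<^sub>c (U - V)" r "p + r" p] fnorm_zero_append_cols[OF UV]
      carrier_append_cols[OF zero_carrier_mat UV, of p] by simp
qed

text \<open>Extending \<open>I - W Y\<close> by an identity block amounts to padding \<open>W\<close> and \<open>Y\<close> with zeros.\<close>

lemma extend_id_compact_WY: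
  assumes W: "W \<in> carrier_mat r q" and Y: "Y \<in> carrier_mat q r"
  shows "(0\<^sub>m p q @\<^sub>r W) * (0\<^sub>m q p @\<^sub>c Y) = 1\<^sub>m (p + r) - extend_id p (1\<^sub>m r - W * Y)"
proof -
  have "(0\<^sub>m p q @\<^sub>r W) * (0\<^sub>m q p @\<^sub>c Y) = 0\<^sub>m p (p + r) @\<^sub>r (0\<^sub>m r p @\<^sub>c (W * Y))"
    using assms by (subst append_rows_mult[of _ p q _ r _ "p + r"])
      (auto simp: mult_append_cols[of _ r q _ p _ r])
  also have "\<dots> = 1\<^sub>m (p + r) - extend_id p (1\<^sub>m r - W * Y)"
    using assms by (intro eq_matI)
      (auto simp: extend_id_def index_append_rows index_append_cols simp del: index_mult_mat(1))
  finally show ?thesis .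
qed

text \<open>Because orthogonal factors preserve the norm, the errors of the two factors add up instead of being
multiplied by norms of the factors. This is what keeps the constants polynomial when
products are nested in the recursion.\<close>

lemma orthogonal_product_perturbation:
  assumes T: "orthogonal_mat n T" and U: "orthogonal_mat n U"
    and car: "T' \<in> carrier_mat n n" "U' \<in> carrier_mat n n"
    and d: "fnorm (T - T') \<le> d" and e: "fnorm (U - U') \<le> e"
  shows "fnorm (T * U - T' * U') \<le> e + d + d * e"
proof -
  note Tc = orthogonal_matD(1)[OF T] and Uc = orthogonal_matD(1)[OF U]
  have eq: "T * U - T' * U' = T * (U - U') + (T - T') * U - (T - T') * (U - U')"
  proof -
    have "T * (U - U') = T * U - T * U'"
      by (rule mult_minus_distrib_mat[OF Tc Uc car(2)])
    moreover have "(T - T') * U = T * U - T' * U" "(T - T') * U' = T * U' - T' * U'"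
      by (rule minus_mult_distrib_mat[OF Tc car(1)]; fact)+
    moreover have "(T - T') * (U - U') = (T - T') * U - (T - T') * U'"
      using Tc Uc car by (intro mult_minus_distrib_mat[of _ n n _ n]) auto
    ultimately show ?thesis
      using Tc Uc car by (auto intro!: eq_matI simp del: index_mult_mat(1))
  qed
  have 1: "fnorm (T * (U - U')) \<le> e"
    using fnorm_orthogonal_mult[OF T, of "U - U'" n] Uc car e by (simp add: minus_carrier_mat)
  have 2: "fnorm ((T - T') * U) \<le> d"
    using fnorm_mult_orthogonal[OF U, of "T - T'" n] Tc car d by (simp add: minus_carrier_mat)
  have "fnorm ((T - T') * (U - U')) \<le> fnorm (T - T') * fnorm (U - U')"
    by (rule fnorm_mult_le[of _ n n _ n]) (use Tc Uc car in auto)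
  also have "\<dots> \<le> d * e"
    using d e order_trans[OF fnorm_nonneg d] by (intro mult_mono) auto
  finally have 3: "fnorm ((T - T') * (U - U')) \<le> d * e" .
  have "fnorm (T * U - T' * U') \<le> fnorm (T * (U - U') + (T - T') * U) + fnorm ((T - T') * (U - U'))"
    unfolding eq by (rule fnorm_minus_le[of _ n n]) (use Tc Uc car in auto)
  also have "fnorm (T * (U - U') + (T - T') * U) \<le> fnorm (T * (U - U')) + fnorm ((T - T') * U)"
    by (rule fnorm_add_le[of _ n n]) (use Tc Uc car in auto)
  finally show ?thesis using 1 2 3 by simp
qed

lemma fnorm_perturbed_orthogonal_mult:
  assumes U: "orthogonal_mat n U" and U': "U' \<in> carrier_mat n n" and B: "B \<in> carrier_mat n m"
    and e: "fnorm (U - U') \<le> e"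
  shows "fnorm (U * B - U' * B) \<le> e * fnorm B" "fnorm (U' * B) \<le> (1 + e) * fnorm B"
proof -
  note Uc = orthogonal_matD(1)[OF U]
  have "U * B - U' * B = (U - U') * B"
    using minus_mult_distrib_mat[OF Uc U' B] by simp
  then have "fnorm (U * B - U' * B) \<le> fnorm (U - U') * fnorm B"
    using fnorm_mult_le[of "U - U'" n n B m] Uc U' B by (simp add: minus_carrier_mat)
  also have "\<dots> \<le> e * fnorm B" using e by (intro mult_right_mono) auto
  finally show 1: "fnorm (U * B - U' * B) \<le> e * fnorm B" .
  have "fnorm (U' * B) \<le> fnorm (U * B) + fnorm (U' * B - U * B)"
    by (rule fnorm_le_add_minus[of _ n m]) (use Uc U' B in auto)
  also have "fnorm (U' * B - U * B) = fnorm (U * B - U' * B)"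
    by (rule fnorm_minus_commute[of _ n m]) (use Uc U' B in auto)
  finally show "fnorm (U' * B) \<le> (1 + e) * fnorm B"
    using 1 fnorm_orthogonal_mult[OF U B] by (simp add: algebra_simps)
qed

lemma accurate_qrD:
  assumes "accurate_qr e f A R W Y" "A \<in> carrier_mat n m"
  obtains U where "orthogonal_mat n U" "fnorm (U - (1\<^sub>m n - W * Y)) \<le> e"
    "fnorm (U * A - (R @\<^sub>r 0\<^sub>m (n - m) m)) \<le> f * fnorm A"
  using assms unfolding accurate_qr_def by auto

text \<open>The witness for the whole matrix is \<open>T * U\<^sub>L\<close> with \<open>T = diag(I, U\<^sub>R)\<close>. With \<open>T' = diag(I, I - W\<^sub>R Y\<^sub>R)\<close> and
\<open>U' = I - W\<^sub>L Y\<^sub>L\<close> the output factors satisfy \<open>I - W Y = T' * U' - (X - T' * W\<^sub>L) * Y\<^sub>L\<close>: in exact arithmetic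
step (d) computes \<open>X = T' * W\<^sub>L\<close>. Thus the error of the transformation consists of those of the two
recursive calls and of the rounding in \<open>X\<close>.

The residual in the first \<open>p\<close> columns is that of the left call, rotated by \<open>T\<close>. In the other columns
it is the difference between \<open>U\<^sub>L * A\<^sub>2\<close> and the computed \<open>A'\<close>, rotated by \<open>T\<close>, plus the residual of the
right call. The bounds \<open>a\<close> and \<open>b\<close> are for the rounding errors of steps (b) and (d).\<close>

lemma accurate_qr_step:
  assumes dims: "p + q \<le> n"
    and A: "A \<in> carrier_mat n (p + q)"
    and L: "R\<^sub>L \<in> carrier_mat p p" "W\<^sub>L \<in> carrier_mat n p" "Y\<^sub>L \<in> carrier_mat p n"
    and accL: "accurate_qr e\<^sub>L f\<^sub>L (slice A 0 n 0 p) R\<^sub>L W\<^sub>L Y\<^sub>L"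
    and A\<^sub>2: "A\<^sub>2 = slice A 0 n p (p + q)"
    and A': "A' \<in> carrier_mat n q"
    and errA: "fnorm (A' - (A\<^sub>2 - W\<^sub>L * (Y\<^sub>L * A\<^sub>2))) \<le> a"
    and R: "R\<^sub>R \<in> carrier_mat q q" "W\<^sub>R \<in> carrier_mat (n - p) q" "Y\<^sub>R \<in> carrier_mat q (n - p)"
    and accR: "accurate_qr e\<^sub>R f\<^sub>R (slice A' p n 0 q) R\<^sub>R W\<^sub>R Y\<^sub>R"
    and X: "X \<in> carrier_mat n p"
    and errX: "fnorm (X - (W\<^sub>L - (0\<^sub>m p p @\<^sub>r W\<^sub>R * (Y\<^sub>R * slice W\<^sub>L p n 0 p)))) \<le> b"
    and f\<^sub>R: "0 \<le> f\<^sub>R" and f\<^sub>L: "0 \<le> f\<^sub>L"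
    and total: "(f\<^sub>L + e\<^sub>L + f\<^sub>R * (1 + e\<^sub>L)) * fnorm A + (1 + f\<^sub>R) * a \<le> f * fnorm A"
  shows "accurate_qr (e\<^sub>L + e\<^sub>R + e\<^sub>R * e\<^sub>L + b * fnorm Y\<^sub>L) f A
      (four_block_mat R\<^sub>L (slice A' 0 p 0 q) (0\<^sub>m q p) R\<^sub>R)
      (X @\<^sub>c (0\<^sub>m p q @\<^sub>r W\<^sub>R)) (Y\<^sub>L @\<^sub>r (0\<^sub>m q p @\<^sub>c Y\<^sub>R))"
    and "fnorm X \<le> (1 + e\<^sub>R) * fnorm W\<^sub>L + b"
proof -
  define r where "r = n - p"
  have n: "n = p + r" and qr: "q \<le> r" using dims by (auto simp: r_def)
  define A\<^sub>1 where "A\<^sub>1 = slice A 0 n 0 p"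
  define B where "B = slice A' p n 0 q"
  define C where "C = slice A' 0 p 0 q"
  have A\<^sub>1c: "A\<^sub>1 \<in> carrier_mat n p" and A\<^sub>2c: "A\<^sub>2 \<in> carrier_mat n q"
    and Bc: "B \<in> carrier_mat r q" and Cc: "C \<in> carrier_mat p q"
    by (auto simp: A\<^sub>1_def A\<^sub>2 B_def C_def n slice_def)
  have A12: "A = A\<^sub>1 @\<^sub>c A\<^sub>2" unfolding A\<^sub>1_def A\<^sub>2 by (rule append_cols_slice[symmetric, OF A]) simp
  have CB: "A' = C @\<^sub>r B" unfolding B_def C_def by (rule append_rows_slice[symmetric, OF A']) (simp add: n)
  have Rc: "W\<^sub>R \<in> carrier_mat r q" "Y\<^sub>R \<in> carrier_mat q r" using R by (auto simp: r_def)
  obtain U\<^sub>L where UL: "orthogonal_mat n U\<^sub>L" "fnorm (U\<^sub>L - (1\<^sub>m n - W\<^sub>L * Y\<^sub>L)) \<le> e\<^sub>L"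
      "fnorm (U\<^sub>L * A\<^sub>1 - (R\<^sub>L @\<^sub>r 0\<^sub>m r p)) \<le> f\<^sub>L * fnorm A\<^sub>1"
    using accL A\<^sub>1c unfolding A\<^sub>1_def[symmetric] r_def by (elim accurate_qrD)
  obtain U\<^sub>R where UR: "orthogonal_mat r U\<^sub>R" "fnorm (U\<^sub>R - (1\<^sub>m r - W\<^sub>R * Y\<^sub>R)) \<le> e\<^sub>R"
      "fnorm (U\<^sub>R * B - (R\<^sub>R @\<^sub>r 0\<^sub>m (r - q) q)) \<le> f\<^sub>R * fnorm B"
    using accR Bc unfolding B_def[symmetric] by (elim accurate_qrD)
  note ULc = orthogonal_matD(1)[OF UL(1)] and URc = orthogonal_matD(1)[OF UR(1)]
  define T where "T = extend_id p U\<^sub>R"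
  define T' where "T' = extend_id p (1\<^sub>m r - W\<^sub>R * Y\<^sub>R)"
  define U' where "U' = 1\<^sub>m n - W\<^sub>L * Y\<^sub>L"
  have WYR: "1\<^sub>m r - W\<^sub>R * Y\<^sub>R \<in> carrier_mat r r" using Rc by auto
  have T: "orthogonal_mat n T" unfolding T_def n by (rule orthogonal_extend_id[OF UR(1)])
  note Tc = orthogonal_matD(1)[OF T]
  have T'c: "T' \<in> carrier_mat n n" and U'c: "U' \<in> carrier_mat n n"
    using WYR L by (auto simp: T'_def U'_def n)
  have TT': "fnorm (T - T') \<le> e\<^sub>R"
    unfolding T_def T'_def fnorm_extend_id_minus[OF URc WYR] by (rule UR(2))
  have UU': "fnorm (U\<^sub>L - U') \<le> e\<^sub>L" unfolding U'_def by (rule UL(2))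

  \<comment> \<open>Splitting the rows of \<open>W\<^sub>L\<close> shows that step (d) without rounding is multiplication by \<open>T'\<close>.\<close>
  define D where "D = slice W\<^sub>L p n 0 p"
  define E where "E = slice W\<^sub>L 0 p 0 p"
  have Dc: "D \<in> carrier_mat r p" and Ec: "E \<in> carrier_mat p p"
    by (auto simp: D_def E_def n slice_def)
  have W\<^sub>L: "W\<^sub>L = E @\<^sub>r D" unfolding D_def E_def by (rule append_rows_slice[symmetric, OF L(2)]) (simp add: n)
  have T'W: "T' * W\<^sub>L = W\<^sub>L - (0\<^sub>m p p @\<^sub>r W\<^sub>R * (Y\<^sub>R * D))"
  proof -
    have "T' * W\<^sub>L = E @\<^sub>r ((1\<^sub>m r - W\<^sub>R * Y\<^sub>R) * D)"
      unfolding T'_def W\<^sub>L by (rule extend_id_append_rows[OF WYR Ec Dc])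
    also have "(1\<^sub>m r - W\<^sub>R * Y\<^sub>R) * D = D - W\<^sub>R * (Y\<^sub>R * D)"
      using Rc Dc by (subst minus_mult_distrib_mat[of _ r r _ _ p])
        (auto simp: assoc_mult_mat[of _ r q _ r _ p])
    also have "E @\<^sub>r (D - W\<^sub>R * (Y\<^sub>R * D)) = W\<^sub>L - (0\<^sub>m p p @\<^sub>r W\<^sub>R * (Y\<^sub>R * D))"
      unfolding W\<^sub>L using Rc Dc Ec by (intro eq_matI)
        (auto simp: index_append_rows simp del: index_mult_mat(1))
    finally show ?thesis .
  qed
  have dX: "fnorm (X - T' * W\<^sub>L) \<le> b" using errX unfolding T'W D_def .
  let ?W = "X @\<^sub>c (0\<^sub>m p q @\<^sub>r W\<^sub>R)" and ?Y = "Y\<^sub>L @\<^sub>r (0\<^sub>m q p @\<^sub>c Y\<^sub>R)"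
  have "?W * ?Y = X * Y\<^sub>L + (0\<^sub>m p q @\<^sub>r W\<^sub>R) * (0\<^sub>m q p @\<^sub>c Y\<^sub>R)"
    by (rule append_cols_mult_append_rows[of _ n p _ q _ n]) (use X L Rc n in auto)
  also have "(0\<^sub>m p q @\<^sub>r W\<^sub>R) * (0\<^sub>m q p @\<^sub>c Y\<^sub>R) = 1\<^sub>m n - T'"
    unfolding T'_def n by (rule extend_id_compact_WY[OF Rc])
  finally have WY: "?W * ?Y = X * Y\<^sub>L + (1\<^sub>m n - T')" .
  have "1\<^sub>m n - ?W * ?Y = T' * U' - (X - T' * W\<^sub>L) * Y\<^sub>L"
  proof -
    have "T' * U' = T' - (T' * W\<^sub>L) * Y\<^sub>L"
      unfolding U'_def using T'c L
      by (subst mult_minus_distrib_mat[of _ n n _ n]) (auto simp: assoc_mult_mat[of _ n n _ p _ n])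
    moreover have "(X - T' * W\<^sub>L) * Y\<^sub>L = X * Y\<^sub>L - (T' * W\<^sub>L) * Y\<^sub>L"
      using X L T'c by (intro minus_mult_distrib_mat[of _ n p _ _ n]) auto
    ultimately show ?thesis
      unfolding WY using X L T'c by (intro eq_matI) (auto simp del: index_mult_mat(1))
  qed
  then have "T * U\<^sub>L - (1\<^sub>m n - ?W * ?Y) = (T * U\<^sub>L - T' * U') + (X - T' * W\<^sub>L) * Y\<^sub>L"
    using X L T'c U'c Tc ULc by (auto intro!: eq_matI simp del: index_mult_mat(1))
  then have "fnorm (T * U\<^sub>L - (1\<^sub>m n - ?W * ?Y))
      \<le> fnorm (T * U\<^sub>L - T' * U') + fnorm ((X - T' * W\<^sub>L) * Y\<^sub>L)"
    using fnorm_add_le[of "T * U\<^sub>L - T' * U'" n n "(X - T' * W\<^sub>L) * Y\<^sub>L"] X L T'c U'c Tc ULc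
    by (simp add: minus_carrier_mat mult_carrier_mat[of _ n n _ n] mult_carrier_mat[of _ n p _ n]
        mult_carrier_mat[of _ n n _ p])
  also have "fnorm (T * U\<^sub>L - T' * U') \<le> e\<^sub>L + e\<^sub>R + e\<^sub>R * e\<^sub>L"
    by (rule orthogonal_product_perturbation[OF T UL(1) T'c U'c TT' UU'])
  also have "fnorm ((X - T' * W\<^sub>L) * Y\<^sub>L) \<le> fnorm (X - T' * W\<^sub>L) * fnorm Y\<^sub>L"
    by (rule fnorm_mult_le[of _ n p _ n]) (use X L T'c in auto)
  also have "\<dots> \<le> b * fnorm Y\<^sub>L" using dX by (intro mult_right_mono) auto
  finally have errU: "fnorm (T * U\<^sub>L - (1\<^sub>m n - ?W * ?Y)) \<le> e\<^sub>L + e\<^sub>R + e\<^sub>R * e\<^sub>L + b * fnorm Y\<^sub>L"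
    by simp

  \<comment> \<open>Regrouping \<open>[R; 0]\<close> by columns allows the residual to be estimated separately for the
    columns of \<open>A\<^sub>1\<close> and of \<open>A\<^sub>2\<close>.\<close>
  let ?R = "four_block_mat R\<^sub>L C (0\<^sub>m q p) R\<^sub>R"
  have R0: "?R @\<^sub>r 0\<^sub>m (n - (p + q)) (p + q)
      = (R\<^sub>L @\<^sub>r 0\<^sub>m r p) @\<^sub>c (C @\<^sub>r (R\<^sub>R @\<^sub>r 0\<^sub>m (r - q) q))"
    using L(1) Cc R(1) qr n by (intro eq_matI) (auto simp: index_append_rows index_append_cols)
  let ?M = "U\<^sub>L * A\<^sub>1" and ?M' = "R\<^sub>L @\<^sub>r 0\<^sub>m r p"
  let ?K = "U\<^sub>L * A\<^sub>2" and ?K' = "C @\<^sub>r (R\<^sub>R @\<^sub>r 0\<^sub>m (r - q) q)"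
  have M'c: "?M' \<in> carrier_mat n p" using L(1) by (auto simp: n)
  have K'c: "?K' \<in> carrier_mat n q" using R(1) Cc qr by (auto simp: n)
  have "(T * U\<^sub>L) * A = (T * ?M) @\<^sub>c (T * ?K)"
    unfolding A12 using Tc ULc A\<^sub>1c A\<^sub>2c
    by (subst mult_append_cols[of _ n n _ p _ q])
      (auto simp: assoc_mult_mat[of _ n n _ n _ p] assoc_mult_mat[of _ n n _ n _ q])
  then have "(T * U\<^sub>L) * A - (?R @\<^sub>r 0\<^sub>m (n - (p + q)) (p + q)) = (T * ?M - ?M') @\<^sub>c (T * ?K - ?K')"
    unfolding R0 using Tc ULc A\<^sub>1c A\<^sub>2c M'c K'c
    by (auto intro!: eq_matI simp: index_append_cols simp del: index_mult_mat(1) dim_append_rows)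
  then have "fnorm ((T * U\<^sub>L) * A - (?R @\<^sub>r 0\<^sub>m (n - (p + q)) (p + q)))
      \<le> fnorm (T * ?M - ?M') + fnorm (T * ?K - ?K')"
    using fnorm_append_cols_le[of "T * ?M - ?M'" n p "T * ?K - ?K'" q] M'c K'c
    by (simp add: minus_carrier_mat)
  also have "fnorm (T * ?M - ?M') \<le> f\<^sub>L * fnorm A\<^sub>1"
  proof -
    \<comment> \<open>\<open>T\<close> acts only on the rows below \<open>R\<^sub>L\<close>, which are zero.\<close>
    have "T * ?M' = ?M'"
      unfolding T_def using URc L(1) by (subst extend_id_append_rows[of _ r _ _ p]) auto
    then have "T * ?M - ?M' = T * (?M - ?M')"
      using Tc ULc A\<^sub>1c M'c by (subst mult_minus_distrib_mat[of _ n n _ p]) auto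
    then show ?thesis
      using fnorm_orthogonal_mult[OF T, of "?M - ?M'" p] UL(3) M'c by (simp add: minus_carrier_mat)
  qed
  also have "fnorm (T * ?K - ?K') \<le> e\<^sub>L * fnorm A\<^sub>2 + a + f\<^sub>R * ((1 + e\<^sub>L) * fnorm A\<^sub>2 + a)"
  proof -
    have U'A: "U' * A\<^sub>2 = A\<^sub>2 - W\<^sub>L * (Y\<^sub>L * A\<^sub>2)"
      unfolding U'_def using L A\<^sub>2c
      by (subst minus_mult_distrib_mat[of _ n n _ _ q]) (auto simp: assoc_mult_mat[of _ n p _ n _ q])
    have dA': "fnorm (A' - U' * A\<^sub>2) \<le> a" unfolding U'A by (rule errA)
    note pert = fnorm_perturbed_orthogonal_mult[OF UL(1) U'c A\<^sub>2c UU']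
    have "fnorm A' \<le> fnorm (U' * A\<^sub>2) + fnorm (A' - U' * A\<^sub>2)"
      by (rule fnorm_le_add_minus[of _ n q]) (use A' U'c A\<^sub>2c in auto)
    moreover have "fnorm B \<le> fnorm A'" unfolding B_def by (rule fnorm_slice_le[OF A']) auto
    ultimately have B: "fnorm B \<le> (1 + e\<^sub>L) * fnorm A\<^sub>2 + a" using pert(2) dA' by simp
    have "fnorm (?K - A') \<le> fnorm (?K - U' * A\<^sub>2) + fnorm (U' * A\<^sub>2 - A')"
      by (rule fnorm_minus_triangle[of _ n q]) (use A' ULc U'c A\<^sub>2c in auto)
    also have "fnorm (U' * A\<^sub>2 - A') = fnorm (A' - U' * A\<^sub>2)"
      by (rule fnorm_minus_commute[of _ n q]) (use A' U'c A\<^sub>2c in auto)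
    finally have KA: "fnorm (?K - A') \<le> e\<^sub>L * fnorm A\<^sub>2 + a" using pert(1) dA' by simp
    have "T * ?K - T * A' = T * (?K - A')"
      using Tc ULc A\<^sub>2c A' by (subst mult_minus_distrib_mat[of _ n n _ q]) auto
    then have 1: "fnorm (T * ?K - T * A') \<le> e\<^sub>L * fnorm A\<^sub>2 + a"
      using fnorm_orthogonal_mult[OF T, of "?K - A'" q] KA A' by (simp add: minus_carrier_mat)
    have "T * A' = C @\<^sub>r (U\<^sub>R * B)"
      unfolding T_def CB by (rule extend_id_append_rows[OF URc Cc Bc])
    then have "T * A' - ?K' = 0\<^sub>m p q @\<^sub>r (U\<^sub>R * B - (R\<^sub>R @\<^sub>r 0\<^sub>m (r - q) q))"
      using URc Bc Cc R(1) qr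
      by (auto intro!: eq_matI simp: index_append_rows simp del: index_mult_mat(1))
    then have "fnorm (T * A' - ?K') = fnorm (U\<^sub>R * B - (R\<^sub>R @\<^sub>r 0\<^sub>m (r - q) q))"
      using fnorm_zero_append_rows[of "U\<^sub>R * B - (R\<^sub>R @\<^sub>r 0\<^sub>m (r - q) q)" r q p]
        carrier_append_rows[OF R(1) zero_carrier_mat, of "r - q"] qr by (simp add: minus_carrier_mat)
    also have "\<dots> \<le> f\<^sub>R * ((1 + e\<^sub>L) * fnorm A\<^sub>2 + a)"
      using UR(3) mult_left_mono[OF B f\<^sub>R] by simp
    finally have 2: "fnorm (T * A' - ?K') \<le> f\<^sub>R * ((1 + e\<^sub>L) * fnorm A\<^sub>2 + a)" .
    have "fnorm (T * ?K - ?K') \<le> fnorm (T * ?K - T * A') + fnorm (T * A' - ?K')"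
      by (rule fnorm_minus_triangle[of _ n q]) (use Tc ULc A\<^sub>2c A' K'c in auto)
    then show ?thesis using 1 2 by simp
  qed
  also have "f\<^sub>L * fnorm A\<^sub>1 + (e\<^sub>L * fnorm A\<^sub>2 + a + f\<^sub>R * ((1 + e\<^sub>L) * fnorm A\<^sub>2 + a))
      = f\<^sub>L * fnorm A\<^sub>1 + (e\<^sub>L + f\<^sub>R * (1 + e\<^sub>L)) * fnorm A\<^sub>2 + (1 + f\<^sub>R) * a"
    by (simp add: algebra_simps)
  also have "\<dots> \<le> f\<^sub>L * fnorm A + (e\<^sub>L + f\<^sub>R * (1 + e\<^sub>L)) * fnorm A + (1 + f\<^sub>R) * a"
  proof -
    have "0 \<le> e\<^sub>L" using UL(2) by (rule order_trans[OF fnorm_nonneg])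
    moreover have "fnorm A\<^sub>1 \<le> fnorm A" "fnorm A\<^sub>2 \<le> fnorm A"
      unfolding A\<^sub>1_def A\<^sub>2 by (rule fnorm_slice_le[OF A]; simp)+
    ultimately show ?thesis using f\<^sub>R f\<^sub>L by (intro add_mono mult_left_mono) auto
  qed
  also have "\<dots> \<le> f * fnorm A" using total by (simp add: algebra_simps)
  finally have errR: "fnorm ((T * U\<^sub>L) * A - (?R @\<^sub>r 0\<^sub>m (n - (p + q)) (p + q))) \<le> f * fnorm A"
    by simp
  show "accurate_qr (e\<^sub>L + e\<^sub>R + e\<^sub>R * e\<^sub>L + b * fnorm Y\<^sub>L) f A
      (four_block_mat R\<^sub>L (slice A' 0 p 0 q) (0\<^sub>m q p) R\<^sub>R) ?W ?Y"
    unfolding accurate_qr_def C_def[symmetric]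
    using orthogonal_mat_mult[OF T UL(1)] errU errR A by (intro exI[of _ "T * U\<^sub>L"]) auto

  have "fnorm X \<le> fnorm (T' * W\<^sub>L) + fnorm (X - T' * W\<^sub>L)"
    by (rule fnorm_le_add_minus[of _ n p]) (use X T'c L in auto)
  then show "fnorm X \<le> (1 + e\<^sub>R) * fnorm W\<^sub>L + b"
    using dX fnorm_perturbed_orthogonal_mult(2)[OF T T'c L(2) TT'] by simp
qed

section \<open>The whole recursion\<close>

lemma accurate_qr_mono:
  assumes "accurate_qr e f A R W Y" "e \<le> e'" "f \<le> f'"
  shows "accurate_qr e' f' A R W Y"
proof -
  have "f * fnorm A \<le> f' * fnorm A" using assms(3) by (intro mult_right_mono) auto
  then show ?thesis using assms(1,2) unfolding accurate_qr_def by fastforce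
qed

lemma zero_append_rows_0 [simp]: "M \<in> carrier_mat r m \<Longrightarrow> 0\<^sub>m 0 m @\<^sub>r M = M"
  by (intro eq_matI) (auto simp: index_append_rows)

text \<open>Steps (b) and (d) are both of this form. In (b) there are no rows on top (\<open>k = 0\<close>) and
\<open>P = B = A\<^sub>2\<close>; in (d) the zero block has \<open>k = p\<close> rows, \<open>P = W\<^sub>L\<close>, and \<open>B\<close> consists of the lower rows
of \<open>W\<^sub>L\<close>. With norms of \<open>W\<close> and \<open>Y\<close> bounded by \<open>3 * N\<close>, the two products cost
\<open>27 * \<kappa> * \<epsilon> * N\<^sup>2\<close> and the subtraction at most \<open>37 * \<epsilon> * N\<^sup>2\<close>.\<close>

lemma fl_compact_WY_apply:
  assumes F: "standard_model \<epsilon> F" "0 \<le> \<epsilon>"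
    and mm: "accurate_matmul (\<kappa> * \<epsilon>) N mm" and \<kappa>: "1 \<le> \<kappa>" "\<kappa> * \<epsilon> \<le> 1" and N: "1 \<le> N"
    and le: "r \<le> N" "l \<le> N" "m \<le> N"
    and W: "W \<in> carrier_mat r l" "fnorm W \<le> 3 * real N"
    and Y: "Y \<in> carrier_mat l r" "fnorm Y \<le> 3 * real N"
    and B: "B \<in> carrier_mat r m" "fnorm B \<le> fnorm P" and P: "P \<in> carrier_mat (k + r) m"
  shows "fnorm (fl_mat_sub F P (0\<^sub>m k m @\<^sub>r mm W (mm Y B)) - (P - (0\<^sub>m k m @\<^sub>r W * (Y * B))))
    \<le> 64 * (\<kappa> * (real N)\<^sup>2 * \<epsilon>) * fnorm P"
proof -
  let ?N2 = "(real N)\<^sup>2" and ?P = "fnorm P"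
  note prod = accurate_matmul_twice[OF mm _ \<kappa>(2) le(1,2,1,3) W(1) Y(1) B(1)]
  have \<kappa>\<epsilon>: "0 \<le> \<kappa> * \<epsilon>" using \<kappa>(1) F(2) by simp
  have N2: "1 \<le> ?N2" using N by simp
  have WYB: "fnorm W * fnorm Y * fnorm B \<le> 9 * ?N2 * ?P"
  proof -
    have "fnorm W * fnorm Y * fnorm B \<le> (3 * real N) * (3 * real N) * ?P"
      by (intro mult_mono W Y B) auto
    then show ?thesis by (simp add: power2_eq_square)
  qed
  define Z where "Z = mm W (mm Y B)"
  have Zc: "Z \<in> carrier_mat r m" unfolding Z_def by (rule prod(1)[OF \<kappa>\<epsilon>])
  have WYBc: "W * (Y * B) \<in> carrier_mat r m" using W(1) Y(1) B(1) by simp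
  define \<theta> where "\<theta> = 27 * (\<kappa> * \<epsilon>) * ?N2 * ?P"
  have "(0\<^sub>m k m @\<^sub>r Z) - (0\<^sub>m k m @\<^sub>r W * (Y * B)) = 0\<^sub>m k m @\<^sub>r (Z - W * (Y * B))"
    using Zc WYBc W(1) by (auto intro!: eq_matI simp: index_append_rows simp del: index_mult_mat(1))
  then have "fnorm ((0\<^sub>m k m @\<^sub>r Z) - (0\<^sub>m k m @\<^sub>r W * (Y * B))) = fnorm (Z - W * (Y * B))"
    using fnorm_zero_append_rows[of "Z - W * (Y * B)" r m k] WYBc by (simp add: minus_carrier_mat)
  also have "\<dots> \<le> 3 * (\<kappa> * \<epsilon>) * (fnorm W * fnorm Y * fnorm B)"
    unfolding Z_def by (rule prod(2)[OF \<kappa>\<epsilon>])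
  also have "\<dots> \<le> 3 * (\<kappa> * \<epsilon>) * (9 * ?N2 * ?P)" using \<kappa>\<epsilon> WYB by (intro mult_left_mono) auto
  also have "\<dots> = \<theta>" by (simp add: \<theta>_def)
  finally have \<theta>: "fnorm ((0\<^sub>m k m @\<^sub>r Z) - (0\<^sub>m k m @\<^sub>r W * (Y * B))) \<le> \<theta>" .
  have "fnorm (0\<^sub>m k m @\<^sub>r W * (Y * B)) = fnorm (W * (Y * B))"
    by (rule fnorm_zero_append_rows[OF WYBc])
  also have "\<dots> \<le> fnorm W * (fnorm Y * fnorm B)"
    by (rule order_trans[OF fnorm_mult_le[of _ r l _ m]])
      (use W(1) Y(1) B(1) in \<open>auto intro!: mult_left_mono fnorm_mult_le\<close>)
  also have "\<dots> \<le> 9 * ?N2 * ?P" using WYB by (simp add: mult.assoc)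
  finally have nWYB: "fnorm (0\<^sub>m k m @\<^sub>r W * (Y * B)) \<le> 9 * ?N2 * ?P" .
  have "fnorm (fl_mat_sub F P (0\<^sub>m k m @\<^sub>r Z) - (P - (0\<^sub>m k m @\<^sub>r W * (Y * B))))
      \<le> \<epsilon> * (?P + fnorm (0\<^sub>m k m @\<^sub>r W * (Y * B)) + \<theta>) + \<theta>"
    by (rule fnorm_fl_mat_sub_perturbed[OF F P _ _ \<theta>]) (use Zc WYBc in auto)
  also have "\<dots> \<le> \<epsilon> * (?N2 * ?P + 9 * ?N2 * ?P + 27 * ?N2 * ?P) + \<theta>"
  proof -
    have "1 * ?P \<le> ?N2 * ?P" using N2 by (intro mult_right_mono) auto
    moreover have "27 * (\<kappa> * \<epsilon>) * ?N2 * ?P \<le> 27 * 1 * ?N2 * ?P"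
      using \<kappa>(2) by (intro mult_right_mono mult_left_mono) auto
    ultimately show ?thesis using nWYB F(2) unfolding \<theta>_def
      by (intro add_mono mult_left_mono order_refl) auto
  qed
  also have "\<dots> = 37 * (1 * (\<epsilon> * ?N2 * ?P)) + 27 * (\<kappa> * (\<epsilon> * ?N2 * ?P))"
    by (simp add: \<theta>_def)
  also have "\<dots> \<le> 37 * (\<kappa> * (\<epsilon> * ?N2 * ?P)) + 27 * (\<kappa> * (\<epsilon> * ?N2 * ?P))"
    using \<kappa>(1) F(2) by (intro add_mono mult_left_mono mult_right_mono) auto
  finally show ?thesis by (simp add: Z_def algebra_simps)
qed

text \<open>In one recursion step the subproblems come with the bounds \<open>x * h\<close>, \<open>x * g\<close> and \<open>y * h\<close>, \<open>y * g\<close> for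
transformation and residual, where \<open>x = 2 * p - 1\<close>, \<open>y = 2 * q - 1\<close>, and the rounding errors of one
step are \<open>64 * u\<close>. The claim is that a step costs no more than one further \<open>h\<close> and \<open>g\<close>. The unit
\<open>h\<close> is large enough for the rounding errors amplified by factors \<open>3 * N\<close> (the norms of \<open>W\<close> and \<open>Y\<close>),
and \<open>g\<close> is a multiple of \<open>N * h\<close> because the error of the left transformation, up to \<open>2 * N * h\<close>,
enters the residual. The products of two errors are of second order, and \<open>16 * h * N\<^sup>2 \<le> 1\<close> makes them
smaller than the remaining slack.\<close>

lemma error_recurrence:
  fixes N u h g x y w :: real
  assumes N: "1 \<le> N" and u: "0 \<le> u" and h: "h = 2000 * u * N\<^sup>2" and small: "16 * h * N\<^sup>2 \<le> 1"
    and g: "g = 8 * N * h" and x: "0 \<le> x" "x \<le> 2 * N" and y: "0 \<le> y" "y \<le> 2 * N"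
  shows "x * h + y * h + (y * h) * (x * h) + 64 * u * (3 * N) * (3 * N) \<le> (x + y + 1) * h"
    and "x * g + x * h + (y * g) * (1 + x * h) + (1 + y * g) * (64 * u) \<le> (x + y + 1) * g"
    and "\<lbrakk>0 \<le> w; w \<le> 3 * N\<rbrakk> \<Longrightarrow> (1 + y * h) * w + 64 * u * (3 * N) \<le> w + 1"
proof -
  have N2: "1 \<le> N\<^sup>2" using N by simp
  have NN2: "N \<le> N\<^sup>2" using N by (simp add: power2_eq_square)
  have h0: "0 \<le> h" using u h by simp
  have g0: "0 \<le> g" using g h0 N by simp
  have uN2: "u \<le> u * N\<^sup>2" "u * N \<le> u * N\<^sup>2"
    using mult_left_mono[OF N2 u] mult_left_mono[OF NN2 u] by auto
  have hN2: "h \<le> h * N\<^sup>2" "h \<le> h * N" using mult_left_mono[OF N2 h0] mult_left_mono[OF N h0] by auto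
  have xyN: "y * x \<le> 4 * N\<^sup>2"
    using mult_mono[OF y(2) x(2)] x y N by (simp add: power2_eq_square)
  have "(y * x) * h \<le> 4 * N\<^sup>2 * h" using xyN h0 by (rule mult_right_mono)
  also have "\<dots> \<le> 1 / 4" using small by (simp add: algebra_simps)
  finally have "((y * x) * h) * h \<le> 1 / 4 * h" using h0 by (rule mult_right_mono)
  then have "(y * h) * (x * h) \<le> 1 / 4 * h" by (simp add: algebra_simps)
  moreover have "64 * u * (3 * N) * (3 * N) = 576 / 2000 * h"
    by (simp add: h power2_eq_square)
  ultimately show "x * h + y * h + (y * h) * (x * h) + 64 * u * (3 * N) * (3 * N) \<le> (x + y + 1) * h"
    using h0 unfolding distrib_right by linarith
  \<comment> \<open>The error in \<open>A'\<close>: that of the left transformation and the rounding of step (b).\<close>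
  define t where "t = x * h + 64 * u"
  have "x * h \<le> 2 * N * h" using x(2) h0 by (rule mult_right_mono)
  moreover have "64 * u \<le> 1 / 2 * (h * N)" using uN2(1) hN2(2) h0 h by linarith
  ultimately have t: "0 \<le> t" "t \<le> 5 / 2 * (N * h)" using x(1) h0 u by (auto simp: t_def algebra_simps)
  have "y * t \<le> (2 * N) * (5 / 2 * (N * h))" using y t N h0 by (intro mult_mono) auto
  also have "\<dots> \<le> 5 / 16" using small by (simp add: power2_eq_square algebra_simps)
  finally have "(y * t) * g \<le> 5 / 16 * g" using g0 by (rule mult_right_mono)
  moreover have "t \<le> 5 / 16 * g" using t(2) by (simp add: g)
  ultimately have "t + y * t * g \<le> g" using g0 by linarith
  then show "x * g + x * h + (y * g) * (1 + x * h) + (1 + y * g) * (64 * u) \<le> (x + y + 1) * g"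
    by (simp add: t_def algebra_simps)
  assume w: "0 \<le> w" "w \<le> 3 * N"
  have "y * w \<le> (2 * N) * (3 * N)" using y w N by (intro mult_mono) auto
  then have "(y * w) * h \<le> (2 * N) * (3 * N) * h" using h0 by (rule mult_right_mono)
  also have "\<dots> \<le> 6 / 16" using small by (simp add: power2_eq_square algebra_simps)
  finally have "y * h * w \<le> 6 / 16" by (simp add: algebra_simps)
  moreover have "64 * u * (3 * N) \<le> h * N\<^sup>2" using uN2(2) hN2(1) h h0 by linarith
  ultimately show "(1 + y * h) * w + 64 * u * (3 * N) \<le> w + 1"
    using small by (simp add: algebra_simps)
qed

text \<open>The recursion tree for \<open>m\<close> columns has \<open>m\<close> Householder leaves and \<open>m - 1\<close> inner nodes, \<open>2 * m - 1\<close> in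
total, and each of them costs one \<open>h\<close> for the transformation and one \<open>g\<close> for the residual. The norms of
\<open>W\<close> and \<open>Y\<close> have to be carried along, since rounding errors are relative to them. They grow at most
linearly: \<open>Y\<close> is assembled from \<open>Y\<^sub>L\<close> and \<open>Y\<^sub>R\<close>, and \<open>X\<close> is a nearly orthogonal image of \<open>W\<^sub>L\<close>. The \<open>- 1\<close>
in the bound for \<open>W\<close> leaves room for the error in \<open>X\<close>.\<close>

lemma qrr_accurate:
  fixes \<epsilon> \<kappa> h g :: real and N :: nat
  assumes F: "standard_model \<epsilon> F" "0 \<le> \<epsilon>"
    and mm: "accurate_matmul (\<kappa> * \<epsilon>) N mm" and \<kappa>: "1 \<le> \<kappa>"
    and small: "32000 * \<kappa> * real N ^ 6 * \<epsilon> \<le> 1"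
    and h: "h = 2000 * \<kappa> * real N ^ 4 * \<epsilon>" and g: "g = 8 * real N * h"
    and dims: "1 \<le> m" "m \<le> n" "n \<le> N" and A: "A \<in> carrier_mat n m"
    and res: "qrr F mm A = (R, W, Y)"
  shows "R \<in> carrier_mat m m \<and> W \<in> carrier_mat n m \<and> Y \<in> carrier_mat m n \<and>
    fnorm W \<le> 3 * real m - 1 \<and> fnorm Y \<le> 3 * real m \<and>
    accurate_qr ((2 * real m - 1) * h) ((2 * real m - 1) * g) A R W Y"
  using dims A res
proof (induction m arbitrary: n A R W Y rule: less_induct)
  case (less m)
  define u where "u = \<kappa> * (real N)\<^sup>2 * \<epsilon>"
  have N: "1 \<le> N" using less.prems by simp
  have Nr: "1 \<le> real N" using N by simp
  have u0: "0 \<le> u" using \<kappa> F(2) by (simp add: u_def)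
  have hu: "h = 2000 * u * (real N)\<^sup>2" by (simp add: h u_def power_numeral_reduce)
  have h16: "16 * h * (real N)\<^sup>2 \<le> 1" using small by (simp add: h power_numeral_reduce algebra_simps)
  have h0: "0 \<le> h" using \<kappa> F(2) by (simp add: h)
  have pw: "real N ^ i \<le> real N ^ j" if "i \<le> j" for i j
    using Nr that by (intro power_increasing) auto
  have \<kappa>\<epsilon>0: "0 \<le> \<kappa> * \<epsilon>" using \<kappa> F(2) by simp
  have \<kappa>\<epsilon>: "\<kappa> * \<epsilon> \<le> 1"
    using mult_left_mono[OF pw[of 0 6] \<kappa>\<epsilon>0] small \<kappa>\<epsilon>0 by (simp add: algebra_simps)
  have N\<epsilon>: "real N * \<epsilon> \<le> \<kappa> * \<epsilon> * real N"
    using mult_right_mono[OF \<kappa>, of "\<epsilon> * real N"] F(2) by (simp add: algebra_simps)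
  show ?case
  proof (cases "m = 1")
    case True
    have Ac: "A \<in> carrier_mat n 1" and n1: "1 \<le> n" using less.prems True by auto
    have res: "householder F A = (R, W, Y)"
      using less.prems(5) Ac by (simp add: qrr.simps Let_def)
    have n\<epsilon>: "real n * \<epsilon> \<le> real N * \<epsilon>"
      using less.prems(3) F(2) by (intro mult_right_mono) auto
    have "\<kappa> * \<epsilon> * real N \<le> \<kappa> * \<epsilon> * real N ^ 6" "\<kappa> * \<epsilon> * real N \<le> \<kappa> * \<epsilon> * real N ^ 4"
      using mult_left_mono[OF pw[of 1 6] \<kappa>\<epsilon>0] mult_left_mono[OF pw[of 1 4] \<kappa>\<epsilon>0] by auto
    then have n6: "32000 * (real n * \<epsilon>) \<le> 1" and n4: "2000 * (real n * \<epsilon>) \<le> h"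
      using n\<epsilon> N\<epsilon> small by (auto simp: h algebra_simps)
    have "0 \<le> real n * \<epsilon>" using F(2) by simp
    then have "160 * real n * \<epsilon> \<le> 1" and e: "270 * real n * \<epsilon> \<le> h" using n6 n4 by simp_all
    note hh = householder_accurate[OF F this(1) Ac n1 res]
    have "1 * h \<le> real N * h" using Nr h0 by (rule mult_right_mono)
    then have f: "5 * real n * \<epsilon> \<le> g" using e h0 \<open>0 \<le> real n * \<epsilon>\<close> n4 by (simp add: g)
    show ?thesis using hh accurate_qr_mono[OF _ e f, of A R W Y] True by simp
  next
    case False
    define p where "p = m div 2"
    define q where "q = m - p"
    have pq: "1 \<le> p" "p < m" "1 \<le> q" "q < m" "p + q = m"
      using less.prems(1) False by (auto simp: p_def q_def)
    have pn: "p \<le> n" "q \<le> n - p" "n - p \<le> N" "p \<le> N" "q \<le> N" "p + q \<le> n"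
      using pq less.prems(2,3) by auto
    have dimA: "dim_row A = n" "dim_col A = m" using less.prems(4) by auto
    obtain R\<^sub>L W\<^sub>L Y\<^sub>L where resL: "qrr F mm (slice A 0 n 0 p) = (R\<^sub>L, W\<^sub>L, Y\<^sub>L)"
      by (metis prod_cases3)
    define A\<^sub>2 where "A\<^sub>2 = slice A 0 n p (p + q)"
    define A' where "A' = fl_mat_sub F A\<^sub>2 (mm W\<^sub>L (mm Y\<^sub>L A\<^sub>2))"
    obtain R\<^sub>R W\<^sub>R Y\<^sub>R where resR: "qrr F mm (slice A' p n 0 q) = (R\<^sub>R, W\<^sub>R, Y\<^sub>R)"
      by (metis prod_cases3)
    define X where "X = fl_mat_sub F W\<^sub>L (0\<^sub>m p p @\<^sub>r mm W\<^sub>R (mm Y\<^sub>R (slice W\<^sub>L p n 0 p)))"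
    have "qrr F mm A = (four_block_mat R\<^sub>L (slice A' 0 p 0 q) (0\<^sub>m q p) R\<^sub>R,
        X @\<^sub>c (0\<^sub>m p q @\<^sub>r W\<^sub>R), Y\<^sub>L @\<^sub>r (0\<^sub>m q p @\<^sub>c Y\<^sub>R))"
      using less.prems(1) False resL resR
      by (subst qrr.simps)
        (simp add: Let_def dimA p_def[symmetric] q_def[symmetric] A\<^sub>2_def[symmetric, unfolded pq(5)]
          A'_def[symmetric] X_def[symmetric])
    then have RWY: "R = four_block_mat R\<^sub>L (slice A' 0 p 0 q) (0\<^sub>m q p) R\<^sub>R"
        "W = X @\<^sub>c (0\<^sub>m p q @\<^sub>r W\<^sub>R)" "Y = Y\<^sub>L @\<^sub>r (0\<^sub>m q p @\<^sub>c Y\<^sub>R)"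
      using less.prems(5) by auto
    have IHL: "R\<^sub>L \<in> carrier_mat p p \<and> W\<^sub>L \<in> carrier_mat n p \<and> Y\<^sub>L \<in> carrier_mat p n \<and>
        fnorm W\<^sub>L \<le> 3 * real p - 1 \<and> fnorm Y\<^sub>L \<le> 3 * real p \<and>
        accurate_qr ((2 * real p - 1) * h) ((2 * real p - 1) * g) (slice A 0 n 0 p) R\<^sub>L W\<^sub>L Y\<^sub>L"
      by (rule less.IH[OF pq(2,1) pn(1) less.prems(3) _ resL]) (simp add: slice_def)
    have IHR: "R\<^sub>R \<in> carrier_mat q q \<and> W\<^sub>R \<in> carrier_mat (n - p) q \<and> Y\<^sub>R \<in> carrier_mat q (n - p) \<and>
        fnorm W\<^sub>R \<le> 3 * real q - 1 \<and> fnorm Y\<^sub>R \<le> 3 * real q \<and>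
        accurate_qr ((2 * real q - 1) * h) ((2 * real q - 1) * g) (slice A' p n 0 q) R\<^sub>R W\<^sub>R Y\<^sub>R"
      by (rule less.IH[OF pq(4,3) pn(2,3) _ resR]) (simp add: slice_def)
    have W\<^sub>Lc: "W\<^sub>L \<in> carrier_mat n p" and Y\<^sub>Lc: "Y\<^sub>L \<in> carrier_mat p n"
      and W\<^sub>Rc: "W\<^sub>R \<in> carrier_mat (n - p) q" and Y\<^sub>Rc: "Y\<^sub>R \<in> carrier_mat q (n - p)"
      using IHL IHR by auto
    have pN: "real p \<le> real N" and qN: "real q \<le> real N" using pn by auto
    have W\<^sub>LN: "fnorm W\<^sub>L \<le> 3 * real N" and Y\<^sub>LN: "fnorm Y\<^sub>L \<le> 3 * real N"
      and W\<^sub>RN: "fnorm W\<^sub>R \<le> 3 * real N" and Y\<^sub>RN: "fnorm Y\<^sub>R \<le> 3 * real N"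
      using IHL IHR pN qN by linarith+
    have A\<^sub>2c: "A\<^sub>2 \<in> carrier_mat n q" by (simp add: A\<^sub>2_def slice_def)
    have A'c: "A' \<in> carrier_mat n q" unfolding A'_def by (rule fl_mat_sub_carrier[OF A\<^sub>2c])
    have Xc: "X \<in> carrier_mat n p" unfolding X_def by (rule fl_mat_sub_carrier[OF W\<^sub>Lc])
    have prodc: "mm W\<^sub>L (mm Y\<^sub>L A\<^sub>2) \<in> carrier_mat n q"
      by (rule accurate_matmul_twice(1)[OF mm \<kappa>\<epsilon>0 \<kappa>\<epsilon> _ _ _ _ W\<^sub>Lc Y\<^sub>Lc A\<^sub>2c]) (use pn less.prems(3) in auto)
    have errA: "fnorm (A' - (A\<^sub>2 - W\<^sub>L * (Y\<^sub>L * A\<^sub>2))) \<le> 64 * u * fnorm A\<^sub>2"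
    proof -
      have "fnorm (fl_mat_sub F A\<^sub>2 (0\<^sub>m 0 q @\<^sub>r mm W\<^sub>L (mm Y\<^sub>L A\<^sub>2)) - (A\<^sub>2 - (0\<^sub>m 0 q @\<^sub>r W\<^sub>L * (Y\<^sub>L * A\<^sub>2))))
          \<le> 64 * (\<kappa> * (real N)\<^sup>2 * \<epsilon>) * fnorm A\<^sub>2"
        by (rule fl_compact_WY_apply[OF F mm \<kappa> \<kappa>\<epsilon> N _ _ _ W\<^sub>Lc W\<^sub>LN Y\<^sub>Lc Y\<^sub>LN A\<^sub>2c])
          (use pn less.prems(3) A\<^sub>2c in auto)
      then show ?thesis
        using prodc W\<^sub>Lc Y\<^sub>Lc A\<^sub>2c by (simp add: A'_def u_def zero_append_rows_0[of _ n])
    qed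
    have errX: "fnorm (X - (W\<^sub>L - (0\<^sub>m p p @\<^sub>r W\<^sub>R * (Y\<^sub>R * slice W\<^sub>L p n 0 p)))) \<le> 64 * u * fnorm W\<^sub>L"
      unfolding X_def u_def
      by (rule fl_compact_WY_apply[OF F mm \<kappa> \<kappa>\<epsilon> N _ _ _ W\<^sub>Rc W\<^sub>RN Y\<^sub>Rc Y\<^sub>RN])
        (use pn W\<^sub>Lc slice_carrier[of W\<^sub>L p n 0 p] fnorm_slice_le[OF W\<^sub>Lc order_refl order_refl, of p 0]
          in auto)
    define x y where "x = 2 * real p - 1" and "y = 2 * real q - 1"
    have xy: "0 \<le> x" "x \<le> 2 * real N" "0 \<le> y" "y \<le> 2 * real N" "x + y + 1 = 2 * real m - 1"
      using pq pN qN by (auto simp: x_def y_def)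
    note num = error_recurrence[OF Nr u0 hu h16 g xy(1-4)]
    have g0: "0 \<le> g" using h0 by (simp add: g)
    have accL: "accurate_qr (x * h) (x * g) (slice A 0 n 0 p) R\<^sub>L W\<^sub>L Y\<^sub>L"
      and accR: "accurate_qr (y * h) (y * g) (slice A' p n 0 q) R\<^sub>R W\<^sub>R Y\<^sub>R"
      using IHL IHR by (auto simp: x_def y_def)
    have Ac: "A \<in> carrier_mat n (p + q)" using less.prems(4) pq(5) by simp
    have total: "(x * g + x * h + y * g * (1 + x * h)) * fnorm A + (1 + y * g) * (64 * u * fnorm A\<^sub>2)
        \<le> ((x + y + 1) * g) * fnorm A"
    proof -
      have "fnorm A\<^sub>2 \<le> fnorm A" unfolding A\<^sub>2_def by (rule fnorm_slice_le[OF Ac]) auto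
      then have "(1 + y * g) * (64 * u * fnorm A\<^sub>2) \<le> (1 + y * g) * (64 * u * fnorm A)"
        using xy g0 u0 by (intro mult_left_mono) auto
      moreover have "(x * g + x * h + (y * g) * (1 + x * h) + (1 + y * g) * (64 * u)) * fnorm A
          \<le> ((x + y + 1) * g) * fnorm A"
        by (rule mult_right_mono[OF num(2)]) simp
      ultimately show ?thesis by (simp add: algebra_simps)
    qed
    have RLc: "R\<^sub>L \<in> carrier_mat p p" and RRc: "R\<^sub>R \<in> carrier_mat q q" using IHL IHR by auto
    have yg: "0 \<le> y * g" "0 \<le> x * g" using xy g0 by auto
    note step = accurate_qr_step[OF pn(6) Ac RLc W\<^sub>Lc Y\<^sub>Lc accL A\<^sub>2_def A'c errA RRc W\<^sub>Rc Y\<^sub>Rc accR Xc errX yg total]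
    have bY: "64 * u * fnorm W\<^sub>L * fnorm Y\<^sub>L \<le> 64 * u * (3 * real N) * (3 * real N)"
      using u0 W\<^sub>LN Y\<^sub>LN by (intro mult_mono) auto
    have acc: "accurate_qr ((2 * real m - 1) * h) ((2 * real m - 1) * g) A R W Y"
      unfolding RWY xy(5)[symmetric]
      by (rule accurate_qr_mono[OF step(1)]) (use num(1) bY in auto)
    have "64 * u * fnorm W\<^sub>L \<le> 64 * u * (3 * real N)" using W\<^sub>LN u0 by (intro mult_left_mono) auto
    then have X3: "fnorm X \<le> fnorm W\<^sub>L + 1"
      using step(2) num(3)[OF fnorm_nonneg W\<^sub>LN] by simp
    have np: "n = p + (n - p)" using pn by simp
    have zWc: "0\<^sub>m p q @\<^sub>r W\<^sub>R \<in> carrier_mat n q" and zYc: "0\<^sub>m q p @\<^sub>c Y\<^sub>R \<in> carrier_mat q n"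
      using carrier_append_rows[OF zero_carrier_mat W\<^sub>Rc, of p] carrier_append_cols[OF zero_carrier_mat Y\<^sub>Rc, of p] np
      by simp_all
    have "fnorm W \<le> fnorm X + fnorm W\<^sub>R"
      unfolding RWY using fnorm_append_cols_le[OF Xc zWc] fnorm_zero_append_rows[OF W\<^sub>Rc, of p] by simp
    then have W3: "fnorm W \<le> 3 * real m - 1" using X3 IHL IHR pq(5) by (auto simp: of_nat_add[symmetric])
    have "fnorm Y \<le> fnorm Y\<^sub>L + fnorm Y\<^sub>R"
      unfolding RWY using fnorm_append_rows_le[OF Y\<^sub>Lc zYc] fnorm_zero_append_cols[OF Y\<^sub>Rc, of p] by simp
    then have Y3: "fnorm Y \<le> 3 * real m" using IHL IHR pq(5) by auto
    have "R \<in> carrier_mat (p + q) (p + q)" unfolding RWY using RLc RRc by simp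
    moreover have "W \<in> carrier_mat n (p + q)" unfolding RWY by (rule carrier_append_cols[OF Xc zWc])
    moreover have "Y \<in> carrier_mat (p + q) n" unfolding RWY by (rule carrier_append_rows[OF Y\<^sub>Lc zYc])
    ultimately show ?thesis using acc W3 Y3 by (simp add: pq(5))
  qed
qed

section \<open>Small machine epsilon\<close>

text \<open>Only finitely many sizes \<open>N' \<le> N\<close> occur, each with its own constant \<open>K\<close>, so that all of the
\<open>K * \<epsilon>\<^sup>2\<close> are eventually below \<open>\<epsilon>\<close>. The factor \<open>N\<close> pays for the passage from the spectral norm to the
Frobenius norm.\<close>

lemma stable_matmul_accurate:
  assumes mm: "stable_matmul mm \<mu>" and M: "\<And>k. k \<le> N \<Longrightarrow> \<bar>\<mu> k\<bar> \<le> M"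
  shows "\<forall>\<^sub>F \<epsilon> in at_right 0. accurate_matmul (real N * (M + 1) * \<epsilon>) N (mm \<epsilon>)"
proof -
  let ?good = "\<lambda>\<epsilon> N'. \<forall>n k m A B.
        max n (max k m) = N' \<longrightarrow> A \<in> carrier_mat n k \<longrightarrow> B \<in> carrier_mat k m \<longrightarrow>
        mm \<epsilon> A B \<in> carrier_mat n m \<and>
        mnorm (mm \<epsilon> A B - A * B) \<le> ((M + 1) * \<epsilon>) * (mnorm A * mnorm B)"
  have "\<forall>\<^sub>F \<epsilon> in at_right 0. ?good \<epsilon> N'" if N': "N' \<le> N" for N'
  proof -
    obtain K where K: "\<forall>\<^sub>F \<epsilon> in at_right 0. \<forall>n k m A B.
        max n (max k m) = N' \<longrightarrow> A \<in> carrier_mat n k \<longrightarrow> B \<in> carrier_mat k m \<longrightarrow>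
        mm \<epsilon> A B \<in> carrier_mat n m \<and>
        mnorm (mm \<epsilon> A B - A * B) \<le> (\<mu> N' * \<epsilon> + K * \<epsilon>\<^sup>2) * (mnorm A * mnorm B)"
      using mm unfolding stable_matmul_def by blast
    have "\<forall>\<^sub>F \<epsilon> in at_right 0. 0 < \<epsilon> \<and> \<epsilon> < 1 / (\<bar>K\<bar> + 1)"
      by (intro eventually_conj eventually_at_right_less eventually_at_rightI[of 0 "1 / (\<bar>K\<bar> + 1)"]) auto
    with K show ?thesis
    proof eventually_elim
      case (elim \<epsilon>)
      then have "\<epsilon> * (\<bar>K\<bar> + 1) < 1" by (simp add: pos_less_divide_eq)
      moreover have "K * \<epsilon> \<le> \<bar>K\<bar> * \<epsilon>" using elim(2) by (intro mult_right_mono) auto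
      moreover have "\<epsilon> * (\<bar>K\<bar> + 1) = \<bar>K\<bar> * \<epsilon> + \<epsilon>" by (simp add: algebra_simps)
      ultimately have "K * \<epsilon> \<le> 1" using elim(2) by linarith
      then have "K * \<epsilon>\<^sup>2 \<le> 1 * \<epsilon>"
        using elim(2) mult_right_mono[of "K * \<epsilon>" 1 \<epsilon>] by (simp add: power2_eq_square mult.assoc)
      moreover have "\<mu> N' * \<epsilon> \<le> M * \<epsilon>"
        using M[OF N'] elim(2) by (intro mult_right_mono) auto
      ultimately have "\<mu> N' * \<epsilon> + K * \<epsilon>\<^sup>2 \<le> (M + 1) * \<epsilon>" by (simp add: algebra_simps)
      then have le: "(\<mu> N' * \<epsilon> + K * \<epsilon>\<^sup>2) * (mnorm A * mnorm B) \<le> ((M + 1) * \<epsilon>) * (mnorm A * mnorm B)" for A B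
        by (intro mult_right_mono) (auto simp: mnorm_nonneg)
      show ?case
      proof (intro allI impI conjI)
        fix n k m and A B :: "real mat"
        assume "max n (max k m) = N'" "A \<in> carrier_mat n k" "B \<in> carrier_mat k m"
        note * = elim(1)[rule_format, OF this]
        show "mm \<epsilon> A B \<in> carrier_mat n m" using * by simp
        show "mnorm (mm \<epsilon> A B - A * B) \<le> ((M + 1) * \<epsilon>) * (mnorm A * mnorm B)"
          using * le[of A B] by linarith
      qed
    qed
  qed
  then have "\<forall>\<^sub>F \<epsilon> in at_right 0. \<forall>N'\<in>{..N}. ?good \<epsilon> N'"
    by (intro eventually_ball_finite) auto
  moreover have "\<forall>\<^sub>F \<epsilon> in at_right (0::real). 0 < \<epsilon>" by (rule eventually_at_right_less)
  ultimately show ?thesis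
  proof eventually_elim
    case (elim \<epsilon>)
    have M0: "0 \<le> M" using M[of 0] by linarith
    show ?case unfolding accurate_matmul_def
    proof (intro allI impI conjI)
      fix n k m and A B :: "real mat"
      assume le: "n \<le> N" "k \<le> N" "m \<le> N" and A: "A \<in> carrier_mat n k" and B: "B \<in> carrier_mat k m"
      have *: "mm \<epsilon> A B \<in> carrier_mat n m \<and>
          mnorm (mm \<epsilon> A B - A * B) \<le> ((M + 1) * \<epsilon>) * (mnorm A * mnorm B)"
        using elim(1)[rule_format, of "max n (max k m)", OF _ refl A B] le by simp
      then show "mm \<epsilon> A B \<in> carrier_mat n m" by simp
      have "sqrt (real m) \<le> real N"
      proof -
        have "real m \<le> (real m)\<^sup>2" by (cases m) (auto simp: power2_eq_square algebra_simps)
        then have "sqrt (real m) \<le> real m" by (rule real_le_lsqrt[rotated]) simp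
        then show ?thesis using le by simp
      qed
      then have "fnorm (mm \<epsilon> A B - A * B) \<le> real N * mnorm (mm \<epsilon> A B - A * B)"
        using fnorm_le_mnorm[of "mm \<epsilon> A B - A * B"] B
          mult_right_mono[of "sqrt (real m)" "real N" "mnorm (mm \<epsilon> A B - A * B)"]
        by (simp add: mnorm_nonneg)
      also have "\<dots> \<le> real N * (((M + 1) * \<epsilon>) * (fnorm A * fnorm B))"
      proof -
        have "mnorm A * mnorm B \<le> fnorm A * fnorm B"
          by (intro mult_mono mnorm_le_fnorm) (auto simp: mnorm_nonneg)
        then have "((M + 1) * \<epsilon>) * (mnorm A * mnorm B) \<le> ((M + 1) * \<epsilon>) * (fnorm A * fnorm B)"
          using M0 elim(2) by (intro mult_left_mono) auto
        then show ?thesis using * by (intro mult_left_mono) auto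
      qed
      finally show "fnorm (mm \<epsilon> A B - A * B) \<le> real N * (M + 1) * \<epsilon> * (fnorm A * fnorm B)"
        by (simp add: algebra_simps)
    qed
  qed
qed

text \<open>The recursion multiplies matrices of all sizes \<open>k \<le> N\<close>, including those below the threshold
from which on the growth condition for \<open>\<mu>\<close> holds; the finitely many values there go into the constant.
A negative exponent is replaced by \<open>0\<close> to have a bound that is monotone in the size.\<close>

lemma polynomial_bound_uniform:
  fixes \<mu> :: "nat \<Rightarrow> real"
  assumes "\<mu> \<in> O(\<lambda>n. real n powr c)"
  obtains C d where "0 \<le> C" "0 \<le> d" "\<And>k N. k \<le> N \<Longrightarrow> 1 \<le> N \<Longrightarrow> \<bar>\<mu> k\<bar> \<le> C * real N powr d"
proof -
  obtain C\<^sub>0 where C\<^sub>0: "0 < C\<^sub>0" "\<forall>\<^sub>F n in sequentially. norm (\<mu> n) \<le> C\<^sub>0 * norm (real n powr c)"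
    using assms by (rule landau_o.bigE)
  then obtain n\<^sub>0 where n\<^sub>0: "\<And>n. n\<^sub>0 \<le> n \<Longrightarrow> \<bar>\<mu> n\<bar> \<le> C\<^sub>0 * real n powr c"
    by (auto simp: eventually_at_top_linorder)
  define S where "S = (\<Sum>n<n\<^sub>0. \<bar>\<mu> n\<bar>)"
  define d where "d = max c 0"
  have S: "0 \<le> S" by (simp add: S_def sum_nonneg)
  have "\<bar>\<mu> k\<bar> \<le> (C\<^sub>0 + S) * real N powr d" if kN: "k \<le> N" "1 \<le> N" for k N
  proof (cases "n\<^sub>0 \<le> k")
    case True
    have "real k powr c \<le> real N powr d"
    proof (cases "k = 0")
      case False
      then have "real k powr c \<le> real k powr d" by (intro powr_mono) (auto simp: d_def)
      also have "\<dots> \<le> real N powr d" using kN by (intro powr_mono2) (auto simp: d_def)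
      finally show ?thesis .
    qed simp
    then have "C\<^sub>0 * real k powr c \<le> (C\<^sub>0 + S) * real N powr d"
      using C\<^sub>0(1) S by (intro mult_mono) auto
    then show ?thesis using n\<^sub>0[OF True] by linarith
  next
    case False
    then have "\<bar>\<mu> k\<bar> \<le> S" unfolding S_def by (intro member_le_sum) auto
    also have "S * 1 \<le> (C\<^sub>0 + S) * real N powr d"
      using C\<^sub>0(1) S kN by (intro mult_mono ge_one_powr_ge_zero) (auto simp: d_def)
    finally show ?thesis by simp
  qed
  then show ?thesis using that[of "C\<^sub>0 + S" d] C\<^sub>0(1) S by (auto simp: d_def)
qed

text \<open>The residual is turned into a backward error by \<open>\<delta>A = U\<^sup>T ([R; 0] - U A)\<close>, which has the
same norm.\<close>

lemma accurate_qr_backward_stable: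
  assumes acc: "accurate_qr e f A R W Y" and A: "A \<in> carrier_mat n m" and le: "m \<le> n"
    and R: "R \<in> carrier_mat m m" and W: "W \<in> carrier_mat n m" and Y: "Y \<in> carrier_mat m n"
  shows "\<exists>\<delta>Q\<^sub>T \<in> carrier_mat n n. \<exists>\<delta>A \<in> carrier_mat n m. \<exists>Q \<in> carrier_mat n n.
          Q\<^sup>T = 1\<^sub>m n - W * Y + \<delta>Q\<^sub>T \<and>
          Q * Q\<^sup>T = 1\<^sub>m n \<and>
          (1\<^sub>m n - W * Y + \<delta>Q\<^sub>T) * (A + \<delta>A) = R @\<^sub>r 0\<^sub>m (n - m) m \<and>
          fnorm \<delta>Q\<^sub>T \<le> e \<and> fnorm \<delta>A \<le> f * fnorm A"
proof -
  define R\<^sub>0 where "R\<^sub>0 = R @\<^sub>r 0\<^sub>m (n - m) m"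
  obtain U where U: "orthogonal_mat n U" "fnorm (U - (1\<^sub>m n - W * Y)) \<le> e"
    "fnorm (U * A - R\<^sub>0) \<le> f * fnorm A"
    using acc A unfolding R\<^sub>0_def by (rule accurate_qrD)
  note Ud = orthogonal_matD[OF U(1)]
  have Rc: "R\<^sub>0 \<in> carrier_mat n m"
    unfolding R\<^sub>0_def
    using carrier_append_rows[OF R zero_carrier_mat, of "n - m"] le by simp
  define \<delta>Q where "\<delta>Q = U - (1\<^sub>m n - W * Y)"
  define \<delta>A where "\<delta>A = U\<^sup>T * (R\<^sub>0 - U * A)"
  have \<delta>Q: "\<delta>Q \<in> carrier_mat n n" using W Y by (auto simp: \<delta>Q_def)
  have \<delta>A: "\<delta>A \<in> carrier_mat n m" using Ud(1) A by (auto simp: \<delta>A_def)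
  have UQ: "1\<^sub>m n - W * Y + \<delta>Q = U"
    unfolding \<delta>Q_def using Ud(1) W Y by (auto intro!: eq_matI simp del: index_mult_mat(1))
  have "U * \<delta>A = R\<^sub>0 - U * A"
    unfolding \<delta>A_def using Ud A Rc
    by (subst assoc_mult_mat[of _ n n _ n _ m, symmetric]) (auto simp: minus_carrier_mat)
  then have "U * (A + \<delta>A) = U * A + (R\<^sub>0 - U * A)"
    using mult_add_distrib_mat[OF Ud(1) A \<delta>A] by simp
  also have "\<dots> = R\<^sub>0"
    using Ud(1) A Rc by (auto intro!: eq_matI simp del: index_mult_mat(1))
  finally have "U * (A + \<delta>A) = R\<^sub>0" .
  moreover have "fnorm \<delta>A \<le> f * fnorm A"
  proof -
    have "fnorm \<delta>A = fnorm (R\<^sub>0 - U * A)"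
      unfolding \<delta>A_def using Ud(1) A
      by (intro fnorm_orthogonal_mult[OF orthogonal_mat_transpose[OF U(1)], of _ m]) auto
    also have "\<dots> = fnorm (U * A - R\<^sub>0)"
      by (rule fnorm_minus_commute[of _ n m]) (use Rc Ud(1) A in auto)
    finally show ?thesis using U(3) by simp
  qed
  ultimately show ?thesis
    using \<delta>Q \<delta>A Ud U(2) unfolding \<delta>Q_def[symmetric] R\<^sub>0_def[symmetric]
    by (intro bexI[of _ \<delta>Q] bexI[of _ \<delta>A] bexI[of _ "U\<^sup>T"]) (simp_all add: UQ)
qed

text \<open>All constants are those of \<open>qrr_accurate\<close> with \<open>N = n\<close>. The transformation error \<open>2 * n * h\<close> is of order
\<open>\<kappa> * n\<^sup>5 * \<epsilon>\<close>; the residual \<open>2 * n * g\<close> is of order \<open>\<kappa> * n\<^sup>6 * \<epsilon>\<close> in the Frobenius norm, and one more factor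
\<open>n\<close> bounds the Frobenius norm of \<open>A\<close> by its spectral norm. Finally \<open>\<kappa>\<close> has order \<open>n\<^bsup>d + 1\<^esup>\<close>.\<close>

theorem lemma4p1:
  fixes arith :: "real \<Rightarrow> fl_arith"
    and mm :: "real \<Rightarrow> real mat \<Rightarrow> real mat \<Rightarrow> real mat"
    and \<mu> :: "nat \<Rightarrow> real"
  assumes "\<forall>\<^sub>F \<epsilon> in at_right 0. standard_model \<epsilon> (arith \<epsilon>)"
    and "stable_matmul mm \<mu>"
    and "\<exists>c::real. \<mu> \<in> O(\<lambda>n. real n powr c)"
  shows "\<exists>C c :: real. \<forall>n m :: nat. 1 \<le> m \<longrightarrow> m \<le> n \<longrightarrow>
    (\<forall>\<^sub>F \<epsilon> in at_right 0. \<forall>A \<in> carrier_mat n m. \<forall>R W Y.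
       qrr (arith \<epsilon>) (mm \<epsilon>) A = (R, W, Y) \<longrightarrow>
       R \<in> carrier_mat m m \<and> W \<in> carrier_mat n m \<and> Y \<in> carrier_mat m n \<and>
       (\<exists>\<delta>Q\<^sub>T \<in> carrier_mat n n. \<exists>\<delta>A \<in> carrier_mat n m. \<exists>Q \<in> carrier_mat n n.
          Q\<^sup>T = 1\<^sub>m n - W * Y + \<delta>Q\<^sub>T \<and>
          Q * Q\<^sup>T = 1\<^sub>m n \<and>
          (1\<^sub>m n - W * Y + \<delta>Q\<^sub>T) * (A + \<delta>A) = R @\<^sub>r 0\<^sub>m (n - m) m \<and>
          mnorm \<delta>Q\<^sub>T \<le> C * real n powr c * \<epsilon> \<and>
          mnorm \<delta>A \<le> C * real n powr c * \<epsilon> * mnorm A))"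
proof -
  obtain c\<^sub>0 where "\<mu> \<in> O(\<lambda>n. real n powr c\<^sub>0)" using assms(3) by blast
  then obtain C\<^sub>1 d where C\<^sub>1: "0 \<le> C\<^sub>1" and d: "0 \<le> d"
    and \<mu>: "\<And>k N. k \<le> N \<Longrightarrow> 1 \<le> N \<Longrightarrow> \<bar>\<mu> k\<bar> \<le> C\<^sub>1 * real N powr d"
    using polynomial_bound_uniform by blast
  define C where "C = 32000 * (C\<^sub>1 + 1)"
  define c where "c = d + 8"
  show ?thesis
  proof (rule exI[of _ C], rule exI[of _ c], intro allI impI)
    fix n m :: nat assume m: "1 \<le> m" "m \<le> n"
    \<comment> \<open>The size \<open>n\<close> is fixed before \<open>\<epsilon>\<close>, so that any positive threshold for \<open>\<epsilon>\<close> in terms of \<open>n\<close> is allowed.\<close>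
    define \<kappa> where "\<kappa> = real n * (C\<^sub>1 * real n powr d + 1)"
    have n1: "1 \<le> real n" using m by simp
    have \<kappa>: "1 \<le> \<kappa>" unfolding \<kappa>_def
      using mult_mono[of 1 "real n" 1 "C\<^sub>1 * real n powr d + 1"] n1 C\<^sub>1 by simp
    have \<kappa>_bound: "32000 * \<kappa> * real n ^ 7 \<le> C * real n powr c"
    proof -
      have "1 \<le> real n powr d" using n1 d by (rule ge_one_powr_ge_zero)
      then have "\<kappa> \<le> real n * ((C\<^sub>1 + 1) * real n powr d)"
        unfolding \<kappa>_def by (intro mult_left_mono) (auto simp: algebra_simps)
      then have "32000 * \<kappa> * real n ^ 7 \<le> 32000 * (real n * ((C\<^sub>1 + 1) * real n powr d)) * real n ^ 7"
        by (intro mult_right_mono mult_left_mono) auto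
      also have "\<dots> = C * (real n powr d * real n ^ 8)"
        by (simp add: C_def power_numeral_reduce)
      also have "real n powr d * real n ^ 8 = real n powr c"
        using n1 by (simp add: c_def powr_add powr_numeral)
      finally show ?thesis .
    qed
    have ev_mm: "\<forall>\<^sub>F \<epsilon> in at_right 0. accurate_matmul (\<kappa> * \<epsilon>) n (mm \<epsilon>)"
      unfolding \<kappa>_def by (rule stable_matmul_accurate[OF assms(2) \<mu>]) (use m in auto)
    have ev_\<epsilon>: "\<forall>\<^sub>F \<epsilon> in at_right 0. 0 < \<epsilon> \<and> \<epsilon> < 1 / (32000 * \<kappa> * real n ^ 6)"
      using \<kappa> n1
      by (intro eventually_conj eventually_at_right_less
          eventually_at_rightI[of 0 "1 / (32000 * \<kappa> * real n ^ 6)"]) auto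
    show "\<forall>\<^sub>F \<epsilon> in at_right 0. \<forall>A \<in> carrier_mat n m. \<forall>R W Y.
       qrr (arith \<epsilon>) (mm \<epsilon>) A = (R, W, Y) \<longrightarrow>
       R \<in> carrier_mat m m \<and> W \<in> carrier_mat n m \<and> Y \<in> carrier_mat m n \<and>
       (\<exists>\<delta>Q\<^sub>T \<in> carrier_mat n n. \<exists>\<delta>A \<in> carrier_mat n m. \<exists>Q \<in> carrier_mat n n.
          Q\<^sup>T = 1\<^sub>m n - W * Y + \<delta>Q\<^sub>T \<and>
          Q * Q\<^sup>T = 1\<^sub>m n \<and>
          (1\<^sub>m n - W * Y + \<delta>Q\<^sub>T) * (A + \<delta>A) = R @\<^sub>r 0\<^sub>m (n - m) m \<and>
          mnorm \<delta>Q\<^sub>T \<le> C * real n powr c * \<epsilon> \<and>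
          mnorm \<delta>A \<le> C * real n powr c * \<epsilon> * mnorm A)"
      using assms(1) ev_mm ev_\<epsilon>
    proof eventually_elim
      case (elim \<epsilon>)
      define h where "h = 2000 * \<kappa> * real n ^ 4 * \<epsilon>"
      define g where "g = 8 * real n * h"
      have \<epsilon>0: "0 \<le> \<epsilon>" using elim(3) by simp
      have small: "32000 * \<kappa> * real n ^ 6 * \<epsilon> \<le> 1"
        using elim(3) \<kappa> n1 by (simp add: pos_less_divide_eq algebra_simps)
      have mn: "0 \<le> 2 * real m - 1" "2 * real m - 1 \<le> 2 * real n" using m by auto
      have h0: "0 \<le> h" using \<kappa> \<epsilon>0 by (simp add: h_def)
      have "32000 * \<kappa> * real n ^ 7 * \<epsilon> \<le> C * real n powr c * \<epsilon>"
        using \<kappa>_bound \<epsilon>0 by (rule mult_right_mono)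
      moreover have "32000 * \<kappa> * real n ^ 7 * \<epsilon> = 16 * (real n) ^ 3 * h"
        by (simp add: h_def power_numeral_reduce)
      ultimately have big: "16 * (real n) ^ 3 * h \<le> C * real n powr c * \<epsilon>" by simp
      show ?case
      proof (intro ballI allI impI)
        fix A R W Y assume A: "A \<in> carrier_mat n m" and res: "qrr (arith \<epsilon>) (mm \<epsilon>) A = (R, W, Y)"
        have main: "R \<in> carrier_mat m m \<and> W \<in> carrier_mat n m \<and> Y \<in> carrier_mat m n \<and>
            fnorm W \<le> 3 * real m - 1 \<and> fnorm Y \<le> 3 * real m \<and>
            accurate_qr ((2 * real m - 1) * h) ((2 * real m - 1) * g) A R W Y"
          by (rule qrr_accurate[OF elim(1) \<epsilon>0 elim(2) \<kappa> small h_def g_def m order_refl A res])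
        then have acc: "accurate_qr ((2 * real m - 1) * h) ((2 * real m - 1) * g) A R W Y"
          and RWY: "R \<in> carrier_mat m m" "W \<in> carrier_mat n m" "Y \<in> carrier_mat m n" by blast+
        obtain \<delta>Q \<delta>A Q where *: "\<delta>Q \<in> carrier_mat n n" "\<delta>A \<in> carrier_mat n m" "Q \<in> carrier_mat n n"
          "Q\<^sup>T = 1\<^sub>m n - W * Y + \<delta>Q" "Q * Q\<^sup>T = 1\<^sub>m n"
          "(1\<^sub>m n - W * Y + \<delta>Q) * (A + \<delta>A) = R @\<^sub>r 0\<^sub>m (n - m) m"
          "fnorm \<delta>Q \<le> (2 * real m - 1) * h" "fnorm \<delta>A \<le> (2 * real m - 1) * g * fnorm A"
          using accurate_qr_backward_stable[OF acc A m(2) RWY] by (elim bexE conjE) (rule that)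
        have "mnorm \<delta>Q \<le> C * real n powr c * \<epsilon>"
        proof -
          have "mnorm \<delta>Q \<le> (2 * real m - 1) * h" using mnorm_le_fnorm *(7) by (rule order_trans)
          also have "\<dots> \<le> 16 * (real n) ^ 3 * h"
          proof -
            have "real n ^ 1 \<le> real n ^ 3" by (rule power_increasing[OF _ n1]) simp
            then have "2 * real m - 1 \<le> 16 * real n ^ 3" using mn(2) n1 unfolding power_one_right by linarith
            then show ?thesis using h0 by (rule mult_right_mono)
          qed
          also note big
          finally show ?thesis .
        qed
        moreover have "mnorm \<delta>A \<le> C * real n powr c * \<epsilon> * mnorm A"
        proof -
          have "fnorm A \<le> sqrt (real m) * mnorm A" using fnorm_le_mnorm[of A] A by simp
          also have "\<dots> \<le> real n * mnorm A"
          proof -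
            have "real m \<le> (real n)\<^sup>2"
              using m mult_mono[of "real m" "real n" 1 "real n"] by (simp add: power2_eq_square)
            then have "sqrt (real m) \<le> real n" by (rule real_le_lsqrt[rotated]) simp
            then show ?thesis by (rule mult_right_mono) (rule mnorm_nonneg)
          qed
          finally have fA: "fnorm A \<le> real n * mnorm A" .
          have "mnorm \<delta>A \<le> (2 * real m - 1) * g * fnorm A" using mnorm_le_fnorm *(8) by (rule order_trans)
          also have "\<dots> \<le> (2 * real n) * g * (real n * mnorm A)"
            using mn h0 fA by (intro mult_mono) (auto simp: g_def)
          also have "\<dots> = (16 * (real n) ^ 3 * h) * mnorm A"
            by (simp add: g_def power_numeral_reduce)
          also have "\<dots> \<le> (C * real n powr c * \<epsilon>) * mnorm A"
            using big mnorm_nonneg by (rule mult_right_mono)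
          finally show ?thesis .
        qed
        ultimately show "R \<in> carrier_mat m m \<and> W \<in> carrier_mat n m \<and> Y \<in> carrier_mat m n \<and>
          (\<exists>\<delta>Q\<^sub>T \<in> carrier_mat n n. \<exists>\<delta>A \<in> carrier_mat n m. \<exists>Q \<in> carrier_mat n n.
          Q\<^sup>T = 1\<^sub>m n - W * Y + \<delta>Q\<^sub>T \<and>
          Q * Q\<^sup>T = 1\<^sub>m n \<and>
          (1\<^sub>m n - W * Y + \<delta>Q\<^sub>T) * (A + \<delta>A) = R @\<^sub>r 0\<^sub>m (n - m) m \<and>
          mnorm \<delta>Q\<^sub>T \<le> C * real n powr c * \<epsilon> \<and>
          mnorm \<delta>A \<le> C * real n powr c * \<epsilon> * mnorm A)"
          using RWY *(1-6) by (intro conjI bexI[of _ \<delta>Q] bexI[of _ \<delta>A] bexI[of _ Q])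
      qed
    qed
  qed
qed

end
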